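(* Let $G$ be an edge-point ribbon graph, and let $k\in\mathbb{N}$. Then $$\Omega(G;w,x,y,z,k)=\sum_{\phi\text{ a }k\text{-valuation of }G_m}(w+x+y+z)^{\mathrm{tot}(\phi)}\,x^{\mathrm{wh}(\phi)}\,y^{\mathrm{bl}(\phi)}\,z^{\mathrm{cr}(\phi)}.$$
   Context: **Ribbon graphs.** A ribbon graph $G=(V(G),E(G))$ is a surface with boundary, represented as the union of two sets of discs, a set $V(G)$ of vertices and a set $E(G)$ of edges, such that: (1) the vertices and edges intersect in disjoint line segments; (2) each such line segment lies on the boundary of precisely one vertex and precisely one edge; (3) every edge contains exactly two such line segments. Equivalence is homeomorphism (orientation preserving when orientable) mapping vertices to vertices and edges to edges. Let $e\in E(G)$. *Deletion:* $G\setminus e$ is obtained by removing the edge $e$. *Contraction:* if $u,v$ are the (not necessarily distinct) vertices incident with $e$, consider the boundary component(s) of $e\cup\{u,v\}$ as curves on $G$; for each curve attach a disc (a new vertex) by identifying its boundary with the curve, and then delete $e,u,v$; the result is $G/e$. *Partial Petrial:* $G^{\tau(e)}$ is obtained by detaching one end of $e$ from its incident vertex $v$, creating arcs $[a,b]$ on $v$ and $[a',b']$ on $e$ (so that $G$ is recovered by identifying $[a,b]$ with $[a',b']$), and reattaching by identifying $[a,b]$ with $[b',a']$ (giving $e$ a half-twist). *Penrose-contraction:* $G\rightthreetimes e:=G^{\tau(e)}/e$. **Edge-point ribbon graphs.** An edge-point ribbon graph is an object obtained from a ribbon graph $(V,E)$ by contracting each edge (disc) in some (possibly empty) subset of $E$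 to a point; the points so created are singular points and the images of the other edges are its edges. Equivalently, it is an edge 2-coloured ribbon graph in which dark grey edges represent those contracted to points and light grey edges are the edges of the edge-point ribbon graph (considered up to partial Petrials of dark grey edges). Deletion, contraction, partial Petriality and Penrose-contraction are inherited by performing the ribbon graph operations on light grey edges in the 2-coloured model; they are not applied to dark grey edges. *Contraction to a point:* $G\odot e$ is obtained by contracting $e$ to a point (recolouring $e$ dark grey). **The polynomial $\Omega$.** $\Omega(G)=\Omega(G;w,x,y,z,t)\in\mathbb{Z}[w,x,y,z,t]$ is the polynomial of edge-point ribbon graphs defined by $\Omega(G)=w\,\Omega(G\odot e)+x\,\Omega(G/e)+y\,\Omega(G\setminus e)+z\,\Omega(G\rightthreetimes e)$ for any edge $e$, and $\Omega(G)=t^{\kappa(G)}$ if $G$ is edgeless, where $\kappa(G)$ is the number of connected components. **Medial graphs.** For a ribbon graph $G$, the medial graph $G_m$ is the 4-regular graph (possibly with free-loops, i.e. circular edges with no incident vertex) embedded in $G$ obtained by: taking one point on each edge of $G$ as the vertices of $G_m$; from each vertex of $G_m$ drawing four non-intersecting curves on that edge of $G$ to the four corners of the edge (the end-points of the arcs where the edge meets its incident vertices); connecting these curves by following the boundary of $G$ around the vertices; and, for each isolated vertex of $G$, adding a free-loop following its boundary. For an edge-point ribbon graph, $G_m$ is obtained by forming the medial graph of a representing edge 2-coloured ribbon graph and declaring the vertices on the dark grey edges to be singular vertices; the other vertices (corresponding to edges of $G$) are non-singular. The canonical checkerboard colouring of $G_m$ colours a region black if it contains a vertex of $G$, and white otherwise.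 Thus at the vertex of $G_m$ on an edge $e$, the two half-edges going to the two corners at the same end of $e$ border a common black region, and the two half-edges going to the two corners on the same side of $e$ border a common white region. **$k$-valuations.** A $k$-valuation $\phi$ of $G_m$ is an edge $k$-colouring of $G_m$, i.e. a map from the edges of $G_m$ (including free-loops) to $\{1,\dots,k\}$, such that each vertex is incident to an even number (possibly zero) of edges (half-edges) of each colour, and all edges incident to a singular vertex have the same colour. At each vertex exactly one of four configurations occurs: *total* (all four half-edges have one colour); or, with two distinct colours $i\ne j$: *white* (the two half-edges bordering each white corner have the same colour, one white corner having colour $i$ and the other $j$), *black* (the two half-edges bordering each black corner have the same colour, one black corner having colour $i$ and the other $j$), *crossing* (opposite half-edges have the same colour). $\mathrm{wh}(\phi),\mathrm{bl}(\phi),\mathrm{cr}(\phi)$ are the numbers of white, black, crossing vertices of $\phi$, and $\mathrm{tot}(\phi)$ is the number of non-singular total vertices of $\phi$ (singular vertices are always total). *)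

theory Defs
  imports "HOL-Computational_Algebra.Polynomial" "HOL-Library.FuncSet"
begin

section \<open>Ribbon graphs\<close>

text \<open>
  Ribbon graphs are considered up to equivalence, and are therefore given by their standard
  combinatorial description. The boundary of an edge disc is cut into four arcs by its four
  \<^emph>\<open>corners\<close>, the end-points of the two segments in which it meets vertices. Each corner is
  the common end-point of exactly three arcs, and is matched by each of them with another corner:

  \<^item> \<open>arc\<close>: the segment shared by the edge and a vertex;
  \<^item> \<open>side\<close>: the part of the boundary of the edge that meets no vertex;
  \<^item> \<open>vline\<close>: the part of the boundary of the vertex running to the next edge end.

  Edges are the orbits of \<open>arc\<close> and \<open>side\<close> (four corners each), vertices with at least one
  incident edge are the orbits of \<open>arc\<close> and \<open>vline\<close>. A vertex meeting no edge has no
  corners; only the number \<open>isolated\<close> of these is recorded.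
\<close>

record 'c ribbon =
  corners :: "'c set"
  arc :: "'c \<Rightarrow> 'c"
  side :: "'c \<Rightarrow> 'c"
  vline :: "'c \<Rightarrow> 'c"
  isolated :: nat

definition matching_on :: "'c set \<Rightarrow> ('c \<Rightarrow> 'c) \<Rightarrow> bool" where
  "matching_on S f \<longleftrightarrow> (\<forall>c\<in>S. f c \<in> S \<and> f c \<noteq> c \<and> f (f c) = c)"

text \<open>The last conjunct says that the boundary of every edge is a 4-cycle arc, side, arc, side.\<close>

definition ribbon_graph :: "('c, 'm) ribbon_scheme \<Rightarrow> bool" where
  "ribbon_graph G \<longleftrightarrow>
     finite (corners G) \<and>
     matching_on (corners G) (arc G) \<and>
     matching_on (corners G) (side G) \<and>
     matching_on (corners G) (vline G) \<and>
     (\<forall>c\<in>corners G. arc G (side G c) = side G (arc G c) \<and> arc G (side G c) \<noteq> c)"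

text \<open>All functions to which this is applied are involutions on \<open>S\<close>, so reachability is symmetric.\<close>

definition orbits :: "'c set \<Rightarrow> ('c \<Rightarrow> 'c) set \<Rightarrow> 'c set set" where
  "orbits S F = (\<lambda>c. {d. (c, d) \<in> {(a, f a) | a f. a \<in> S \<and> f \<in> F}\<^sup>*}) ` S"

definition edges :: "('c, 'm) ribbon_scheme \<Rightarrow> 'c set set" where
  "edges G = orbits (corners G) {arc G, side G}"

definition num_components :: "('c, 'm) ribbon_scheme \<Rightarrow> nat" where
  "num_components G = card (orbits (corners G) {arc G, side G, vline G}) + isolated G"

text \<open>
  \<open>remove_edge j e G\<close> discards the edge \<open>e\<close>, where the boundaries of the new vertices are the
  closed curves that agree with the boundaries of the old vertices except that at \<open>e\<close> they run
  along the two arcs of \<open>e\<close> that \<open>j\<close> matches: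

  \<^item> \<open>j = arc G\<close>: they are the boundaries of the vertices of \<open>G\<close>;
  \<^item> \<open>j = side G\<close>: they are the boundary components of the union of \<open>e\<close> and its incident
    vertices (together with the boundaries of the other vertices).

  A new vertex line starts at a corner outside \<open>e\<close>, and each time it arrives at a corner of
  \<open>e\<close> it crosses \<open>e\<close> by \<open>j\<close> and goes on along the next old vertex line. As \<open>j\<close> matches the four
  corners of \<open>e\<close> in two pairs, it crosses \<open>e\<close> at most twice. The curves that meet only
  corners of \<open>e\<close> bound the new isolated vertices.
\<close>

definition vertex_curves ::
    "('c \<Rightarrow> 'c) \<Rightarrow> 'c set \<Rightarrow> ('c, 'm) ribbon_scheme \<Rightarrow> 'c set set" where
  "vertex_curves j e G =
     orbits (corners G) {vline G, \<lambda>c. if c \<in> e then j c else arc G c}"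

definition remove_edge ::
    "('c \<Rightarrow> 'c) \<Rightarrow> 'c set \<Rightarrow> ('c, 'm) ribbon_scheme \<Rightarrow> ('c, 'm) ribbon_scheme" where
  "remove_edge j e G =
     G\<lparr>corners := corners G - e,
       vline := \<lambda>c. ((\<lambda>d. if d \<in> e then vline G (j d) else d) ^^ 2) (vline G c),
       isolated := isolated G + card {C \<in> vertex_curves j e G. C \<subseteq> e}\<rparr>"

definition delete :: "('c, 'm) ribbon_scheme \<Rightarrow> 'c set \<Rightarrow> ('c, 'm) ribbon_scheme" where
  "delete G e = remove_edge (arc G) e G"

definition contract :: "('c, 'm) ribbon_scheme \<Rightarrow> 'c set \<Rightarrow> ('c, 'm) ribbon_scheme" where
  "contract G e = remove_edge (side G) e G"

text \<open>
  Reattaching one end of \<open>e\<close> with its two corners interchanged: a side of \<open>e\<close> that used to end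
  at a corner of that end now ends at the other one. The result does not depend on the end chosen.
\<close>

definition partial_petrial :: "('c, 'm) ribbon_scheme \<Rightarrow> 'c set \<Rightarrow> ('c, 'm) ribbon_scheme" where
  "partial_petrial G e = G\<lparr>side := \<lambda>c. if c \<in> e then side G (arc G c) else side G c\<rparr>"

definition penrose_contract :: "('c, 'm) ribbon_scheme \<Rightarrow> 'c set \<Rightarrow> ('c, 'm) ribbon_scheme" where
  "penrose_contract G e = contract (partial_petrial G e) e"


section \<open>Edge-point ribbon graphs\<close>

text \<open>
  An edge-point ribbon graph is given by an edge 2-coloured ribbon graph representing it; the dark
  edges are those contracted to points. The operations above are inherited. Representatives that
  differ by partial Petrials of dark edges represent the same edge-point ribbon graph; everything
  is defined and stated for arbitrary representatives.
\<close>

record 'c ep_ribbon = "'c ribbon" +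
  dark :: "'c set set"

definition edge_point_ribbon_graph :: "'c ep_ribbon \<Rightarrow> bool" where
  "edge_point_ribbon_graph G \<longleftrightarrow> ribbon_graph G \<and> dark G \<subseteq> edges G"

definition light_edges :: "'c ep_ribbon \<Rightarrow> 'c set set" where
  "light_edges G = edges G - dark G"

definition contract_to_point :: "'c ep_ribbon \<Rightarrow> 'c set \<Rightarrow> 'c ep_ribbon" where
  "contract_to_point G e = G\<lparr>dark := insert e (dark G)\<rparr>"


section \<open>The polynomial Omega\<close>

text \<open>
  The ring \<open>\<int>[w,x,y,z]\<close> is \<open>\<int>[w][x][y][z]\<close>, and \<open>\<int>[w,x,y,z,t]\<close> is the ring of polynomials
  in \<open>t\<close> over it.
\<close>

type_synonym wxyz = "int poly poly poly poly"

definition var_w :: wxyz where "var_w = [:[:[:[:0, 1:]:]:]:]"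
definition var_x :: wxyz where "var_x = [:[:[:0, 1:]:]:]"
definition var_y :: wxyz where "var_y = [:[:0, 1:]:]"
definition var_z :: wxyz where "var_z = [:0, 1:]"
definition var_t :: "wxyz poly" where "var_t = [:0, 1:]"

definition Omega_relations :: "('c ep_ribbon \<Rightarrow> wxyz poly) \<Rightarrow> bool" where
  "Omega_relations P \<longleftrightarrow>
     (\<forall>G. edge_point_ribbon_graph G \<longrightarrow>
        (light_edges G = {} \<longrightarrow> P G = var_t ^ num_components G) \<and>
        (\<forall>e\<in>light_edges G.
           P G = [:var_w:] * P (contract_to_point G e) + [:var_x:] * P (contract G e)
               + [:var_y:] * P (delete G e) + [:var_z:] * P (penrose_contract G e)))"

text \<open>
  By induction on the number of light edges, the relations determine the values on edge-point
  ribbon graphs.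
\<close>

definition Omega :: "'c ep_ribbon \<Rightarrow> wxyz poly" where
  "Omega = (SOME P. Omega_relations P)"


section \<open>Medial graphs and valuations\<close>

text \<open>
  The vertices of the medial graph of \<open>G\<close> are the edges of \<open>G\<close>, and its half-edges at \<open>e\<close>
  are the four curves on \<open>e\<close> from the medial vertex to the corners \<open>c \<in> e\<close>, identified with
  these corners. The half-edges \<open>c\<close> and \<open>vline G c\<close> are connected along the boundary of a vertex
  and form one edge; every isolated vertex gives a free-loop.
  In the cyclic order \<open>c\<close>, \<open>arc G c\<close>, \<open>side G (arc G c)\<close>, \<open>side G c\<close> of the half-edges
  around a medial vertex, \<open>c\<close> and \<open>arc G c\<close> (same end of \<open>e\<close>) border a black region, \<open>c\<close> and
  \<open>side G c\<close> (same side of \<open>e\<close>) a white region, and \<open>c\<close> is opposite to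
  \<open>arc G (side G c)\<close>.
\<close>

datatype 'c medial_edge = Line "'c set" | Free_Loop nat

definition medial_vertices :: "'c ep_ribbon \<Rightarrow> 'c set set" where
  "medial_vertices G = edges G"

definition singular_vertices :: "'c ep_ribbon \<Rightarrow> 'c set set" where
  "singular_vertices G = dark G"

definition edge_of_half :: "'c ep_ribbon \<Rightarrow> 'c \<Rightarrow> 'c medial_edge" where
  "edge_of_half G c = Line {c, vline G c}"

definition medial_edges :: "'c ep_ribbon \<Rightarrow> 'c medial_edge set" where
  "medial_edges G = edge_of_half G ` corners G \<union> Free_Loop ` {..<isolated G}"

definition total_at :: "'c ep_ribbon \<Rightarrow> ('c medial_edge \<Rightarrow> nat) \<Rightarrow> 'c set \<Rightarrow> bool" where
  "total_at G \<phi> v \<longleftrightarrow> (\<forall>c\<in>v. \<forall>d\<in>v. \<phi> (edge_of_half G c) = \<phi> (edge_of_half G d))"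

definition white_at :: "'c ep_ribbon \<Rightarrow> ('c medial_edge \<Rightarrow> nat) \<Rightarrow> 'c set \<Rightarrow> bool" where
  "white_at G \<phi> v \<longleftrightarrow> \<not> total_at G \<phi> v \<and>
     (\<forall>c\<in>v. \<phi> (edge_of_half G c) = \<phi> (edge_of_half G (side G c)))"

definition black_at :: "'c ep_ribbon \<Rightarrow> ('c medial_edge \<Rightarrow> nat) \<Rightarrow> 'c set \<Rightarrow> bool" where
  "black_at G \<phi> v \<longleftrightarrow> \<not> total_at G \<phi> v \<and>
     (\<forall>c\<in>v. \<phi> (edge_of_half G c) = \<phi> (edge_of_half G (arc G c)))"

definition crossing_at :: "'c ep_ribbon \<Rightarrow> ('c medial_edge \<Rightarrow> nat) \<Rightarrow> 'c set \<Rightarrow> bool" where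
  "crossing_at G \<phi> v \<longleftrightarrow> \<not> total_at G \<phi> v \<and>
     (\<forall>c\<in>v. \<phi> (edge_of_half G c) = \<phi> (edge_of_half G (arc G (side G c))))"

text \<open>
  Valuations are extensional functions on the edges of the medial graph, so that each colouring
  is counted once. Counting half-edges makes a loop contribute two to the parity condition.
\<close>

definition valuations :: "nat \<Rightarrow> 'c ep_ribbon \<Rightarrow> ('c medial_edge \<Rightarrow> nat) set" where
  "valuations k G =
     {\<phi> \<in> medial_edges G \<rightarrow>\<^sub>E {1..k}.
        (\<forall>v\<in>medial_vertices G. \<forall>i\<in>{1..k}. even (card {c \<in> v. \<phi> (edge_of_half G c) = i})) \<and>
        (\<forall>v\<in>singular_vertices G. \<forall>c\<in>v. \<forall>d\<in>v. \<phi> (edge_of_half G c) = \<phi> (edge_of_half G d))}"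

definition tot :: "'c ep_ribbon \<Rightarrow> ('c medial_edge \<Rightarrow> nat) \<Rightarrow> nat" where
  "tot G \<phi> = card {v \<in> medial_vertices G - singular_vertices G. total_at G \<phi> v}"

definition wh :: "'c ep_ribbon \<Rightarrow> ('c medial_edge \<Rightarrow> nat) \<Rightarrow> nat" where
  "wh G \<phi> = card {v \<in> medial_vertices G. white_at G \<phi> v}"

definition bl :: "'c ep_ribbon \<Rightarrow> ('c medial_edge \<Rightarrow> nat) \<Rightarrow> nat" where
  "bl G \<phi> = card {v \<in> medial_vertices G. black_at G \<phi> v}"

definition cr :: "'c ep_ribbon \<Rightarrow> ('c medial_edge \<Rightarrow> nat) \<Rightarrow> nat" where
  "cr G \<phi> = card {v \<in> medial_vertices G. crossing_at G \<phi> v}"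

end

theory Submission
  imports Defs
begin

text \<open>
  The right-hand side of the theorem satisfies the recursion that defines \<open>Omega\<close>. To see this,
  a valuation is read as a colouring of the half-edges of the medial graph, that is of the corners
  of \<open>G\<close>, in which the two ends of each vertex line agree, together with a free choice of
  colour for each isolated vertex. The evenness condition at a medial vertex says that its four
  half-edges agree in pairs along the sides, along the arcs, or diagonally, and a total vertex
  is one where all three happen at once. Hence the factor contributed by a light edge is
  \<open>w [all equal] + x [equal along sides] + y [equal along arcs] + z [equal diagonally]\<close>,
  which is \<open>w + x + y + z\<close> at a total vertex, \<open>x\<close>, \<open>y\<close> or \<open>z\<close> at a white, black or crossing
  one, and \<open>0\<close> where the colouring is not a valuation. So the sum over valuations is
  the \<open>state_sum\<close>, a sum over all vertex-line colourings of a product over the edges, in which no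
  parity condition is left (\<open>state_sum_eq_valuation_sum\<close>).

  Expanding the factor of one light edge \<open>e\<close> gives four sums. The first runs over the
  colourings that are constant on \<open>e\<close>, which is the state sum of the graph with \<open>e\<close> contracted
  to a point. Each of the others runs over the colourings that agree on \<open>e\<close> along a pairing \<open>j\<close>
  of its four corners. Such a colouring is constant along the curves obtained by joining vertex
  lines through \<open>j\<close>, so it is a colouring of the graph with \<open>e\<close> removed along \<open>j\<close> and a
  colour for each curve that closes up inside \<open>e\<close>; these curves are the new isolated vertices
  (\<open>sum_colourings_remove_edge\<close>). The three pairings give contraction, deletion and
  Penrose-contraction, and this is the recursion (\<open>state_sum_recursion\<close>). Without light edges,
  only the colourings constant on connected components survive (\<open>state_sum_edgeless\<close>).

  It remains to know that a polynomial satisfying the recursion for \<^emph>\<open>every\<close> choice of \<open>e\<close> exists,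
  since \<open>Omega\<close> is chosen among the solutions. This is a consequence of the same
  computation: expanding along arbitrarily chosen edges shows that the state sums at
  \<open>k = 0, 1, 2, \<dots>\<close> are interpolated by some polynomial, and as a polynomial is determined by these
  values, the interpolating polynomials inherit the recursion for every edge
  (\<open>Omega_relations_Omega\<close>).
\<close>

section \<open>Orbits of involutions\<close>

text \<open>
  A single class of \<open>orbits\<close>, so that classes can be named by a corner that they contain.
\<close>

definition orbit :: "'c set \<Rightarrow> ('c \<Rightarrow> 'c) set \<Rightarrow> 'c \<Rightarrow> 'c set" where
  "orbit S F c = {d. (c, d) \<in> {(a, f a) | a f. a \<in> S \<and> f \<in> F}\<^sup>*}"

lemma orbits_image: "orbits S F = orbit S F ` S"
  by (simp add: orbits_def orbit_def)

lemma orbit_self: "c \<in> orbit S F c"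
  by (simp add: orbit_def)

lemma orbit_step:
  assumes "d \<in> orbit S F c" "d \<in> S" "f \<in> F"
  shows "f d \<in> orbit S F c"
  using assms unfolding orbit_def by (auto intro: rtrancl.rtrancl_into_rtrancl)

lemma orbit_least:
  assumes "c \<in> X" "\<And>f d. f \<in> F \<Longrightarrow> d \<in> X \<Longrightarrow> f d \<in> X"
  shows "orbit S F c \<subseteq> X"
proof
  fix d assume "d \<in> orbit S F c"
  then have "(c, d) \<in> {(a, f a) | a f. a \<in> S \<and> f \<in> F}\<^sup>*" by (simp add: orbit_def)
  then show "d \<in> X" by (induction) (use assms in auto)
qed

lemma orbit_subset:
  assumes "\<And>f. f \<in> F \<Longrightarrow> matching_on S f" "c \<in> S"
  shows "orbit S F c \<subseteq> S"
  using assms by (intro orbit_least) (auto simp: matching_on_def)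

text \<open>
  Reachability is symmetric because every generator undoes itself, so the orbits partition \<open>S\<close>.
\<close>

lemma orbit_eq:
  assumes inv: "\<And>f. f \<in> F \<Longrightarrow> matching_on S f" and "c \<in> S" "d \<in> orbit S F c"
  shows "orbit S F d = orbit S F c"
proof -
  let ?R = "{(a, f a) | a f. a \<in> S \<and> f \<in> F}"
  have "sym ?R"
  proof (rule symI)
    fix a b assume "(a, b) \<in> ?R"
    then obtain f where f: "f \<in> F" "a \<in> S" "b = f a" by auto
    then have "b \<in> S" "f b = a" using inv[OF f(1)] by (auto simp: matching_on_def)
    then show "(b, a) \<in> ?R" using f(1) by (auto intro!: exI[of _ b] exI[of _ f])
  qed
  then have s: "sym (?R\<^sup>*)" by (rule sym_rtrancl)
  have "(c, d) \<in> ?R\<^sup>*" using assms(3) by (simp add: orbit_def)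
  moreover have "(d, c) \<in> ?R\<^sup>*" using s calculation by (rule symD)
  ultimately show ?thesis by (auto simp: orbit_def intro: rtrancl_trans)
qed

lemma orbits_member:
  assumes "\<And>f. f \<in> F \<Longrightarrow> matching_on S f" "C \<in> orbits S F" "c \<in> C"
  shows "c \<in> S" "C = orbit S F c"
proof -
  obtain b where b: "b \<in> S" "C = orbit S F b" using assms(2) by (auto simp: orbits_image)
  show "c \<in> S" using orbit_subset[OF assms(1) b(1)] b(2) assms(3) by auto
  show "C = orbit S F c" using orbit_eq[OF assms(1) b(1)] b(2) assms(3) by simp
qed

lemma orbit_constant:
  assumes "\<And>f a. f \<in> F \<Longrightarrow> a \<in> X \<Longrightarrow> u (f a) = u a" "orbit S F c \<subseteq> X" "d \<in> orbit S F c"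
  shows "u d = u c"
proof -
  let ?R = "{(a, f a) | a f. a \<in> S \<and> f \<in> F}"
  have "(c, d) \<in> ?R\<^sup>*" using assms(3) by (simp add: orbit_def)
  then have "d \<in> X \<and> u d = u c"
  proof induction
    case base then show ?case using assms(2) orbit_self by fastforce
  next
    case (step y z)
    have "z \<in> orbit S F c"
      using step.hyps by (auto simp: orbit_def intro: rtrancl.rtrancl_into_rtrancl)
    then show ?case using step assms(1,2) by auto
  qed
  then show ?thesis ..
qed

text \<open>
  An invariant function is a choice of one value for each orbit. A subfamily of the orbits is
  allowed because this count is used twice: for the connected components, where it is the family
  of all orbits, and for the curves that close up inside a removed edge.
\<close>

lemma card_invariant_functions:
  assumes fin: "finite S" and inv: "\<And>f. f \<in> F \<Longrightarrow> matching_on S f"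
    and CC: "CC \<subseteq> orbits S F"
  shows "card {u \<in> \<Union>CC \<rightarrow>\<^sub>E B. \<forall>c\<in>\<Union>CC. \<forall>f\<in>F. u (f c) = u c} = card B ^ card CC"
proof -
  let ?A = "{u \<in> \<Union>CC \<rightarrow>\<^sub>E B. \<forall>c\<in>\<Union>CC. \<forall>f\<in>F. u (f c) = u c}"
  let ?to = "\<lambda>u. \<lambda>C\<in>CC. u (SOME c. c \<in> C)"
  let ?from = "\<lambda>g. \<lambda>c\<in>\<Union>CC. g (orbit S F c)"
  have mem: "c \<in> S \<and> C = orbit S F c" if "C \<in> CC" "c \<in> C" for C c
    using orbits_member[OF inv _ that(2)] that(1) CC by blast
  have some: "(SOME c. c \<in> C) \<in> C" if "C \<in> CC" for C
  proof -
    have "\<exists>c. c \<in> C" using that CC orbit_self by (fastforce simp: orbits_image)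
    then show ?thesis by (rule someI_ex)
  qed
  have "finite CC" using CC fin by (auto simp: orbits_image intro: finite_subset)
  have "bij_betw ?to ?A (CC \<rightarrow>\<^sub>E B)"
  proof (rule bij_betw_byWitness[where f' = ?from])
    show "\<forall>u\<in>?A. ?from (?to u) = u"
    proof
      fix u assume u: "u \<in> ?A"
      show "?from (?to u) = u"
      proof
        fix c
        show "?from (?to u) c = u c"
        proof (cases "c \<in> \<Union>CC")
          case True
          then obtain C where C: "C \<in> CC" "c \<in> C" by auto
          then have eq: "C = orbit S F c" using mem by auto
          have "u (SOME c. c \<in> C) = u c"
          proof (rule orbit_constant[where F = F and S = S and X = "\<Union>CC"])
            show "(SOME c. c \<in> C) \<in> orbit S F c" using some[OF C(1)] eq by simp
            show "orbit S F c \<subseteq> \<Union>CC" using eq C by auto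
          qed (use u in blast)
          then show ?thesis using True C eq by simp
        next
          case False then show ?thesis using u by (simp add: PiE_def extensional_def)
        qed
      qed
    qed
    show "\<forall>g\<in>CC \<rightarrow>\<^sub>E B. ?to (?from g) = g"
    proof
      fix g assume g: "g \<in> CC \<rightarrow>\<^sub>E B"
      show "?to (?from g) = g"
      proof
        fix C
        show "?to (?from g) C = g C"
        proof (cases "C \<in> CC")
          case True
          then show ?thesis using some[OF True] mem[OF True some[OF True]] by auto
        next
          case False then show ?thesis using g by (simp add: PiE_def extensional_def)
        qed
      qed
    qed
    have "u (SOME c. c \<in> C) \<in> B" if "u \<in> \<Union>CC \<rightarrow>\<^sub>E B" "C \<in> CC" for u C
      using that some[OF that(2)] by (intro PiE_mem[OF that(1)]) blast
    then show "?to ` ?A \<subseteq> CC \<rightarrow>\<^sub>E B" by auto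
    show "?from ` (CC \<rightarrow>\<^sub>E B) \<subseteq> ?A"
    proof
      fix u assume "u \<in> ?from ` (CC \<rightarrow>\<^sub>E B)"
      then obtain g where g: "g \<in> CC \<rightarrow>\<^sub>E B" "u = ?from g" by auto
      have o: "orbit S F c \<in> CC" if "c \<in> \<Union>CC" for c using that mem by auto
      have "u (f c) = u c" if "c \<in> \<Union>CC" "f \<in> F" for c f
      proof -
        have c: "c \<in> S" using that mem by auto
        have fc: "f c \<in> orbit S F c" by (rule orbit_step[OF orbit_self c that(2)])
        then have "f c \<in> \<Union>CC" using o[OF that(1)] by auto
        then show ?thesis using orbit_eq[OF inv c fc] g(2) that(1) by simp
      qed
      moreover have "u \<in> \<Union>CC \<rightarrow>\<^sub>E B" using g o by (auto simp: PiE_def Pi_def)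
      ultimately show "u \<in> ?A" by blast
    qed
  qed
  then have "card ?A = card (CC \<rightarrow>\<^sub>E B)" by (rule bij_betw_same_card)
  then show ?thesis using \<open>finite CC\<close> by (simp add: card_funcsetE)
qed

section \<open>Edges\<close>

lemma ribbon_graphD:
  assumes "ribbon_graph G"
  shows "finite (corners G)" "matching_on (corners G) (arc G)" "matching_on (corners G) (side G)"
    "matching_on (corners G) (vline G)"
    "\<And>c. c \<in> corners G \<Longrightarrow> arc G (side G c) = side G (arc G c)"
    "\<And>c. c \<in> corners G \<Longrightarrow> arc G (side G c) \<noteq> c"
  using assms by (auto simp: ribbon_graph_def)

lemma matching_onD:
  assumes "matching_on S f" "c \<in> S"
  shows "f c \<in> S" "f c \<noteq> c" "f (f c) = c"
  using assms by (auto simp: matching_on_def)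

lemma matching_on_subset:
  assumes "matching_on S f" "T \<subseteq> S" "\<And>c. c \<in> T \<Longrightarrow> f c \<in> T"
  shows "matching_on T f"
  using assms by (auto simp: matching_on_def)

text \<open>
  On a ribbon graph this is the orbit of \<open>c\<close> under \<open>arc\<close> and \<open>side\<close>, since the two commute.
\<close>

definition edge_of :: "('c, 'm) ribbon_scheme \<Rightarrow> 'c \<Rightarrow> 'c set" where
  "edge_of G c = {c, arc G c, side G c, arc G (side G c)}"

lemma edges_eq:
  assumes "ribbon_graph G"
  shows "edges G = edge_of G ` corners G"
proof -
  note G = ribbon_graphD[OF assms]
  have "orbit (corners G) {arc G, side G} c = edge_of G c" if c: "c \<in> corners G" for c
  proof
    note C = matching_onD[OF G(2) c] matching_onD[OF G(3) c]
    note C' = matching_onD[OF G(2) C(4)] matching_onD[OF G(3) C(1)] G(5)[OF c]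
    show "orbit (corners G) {arc G, side G} c \<subseteq> edge_of G c"
      by (rule orbit_least) (use C C' in \<open>auto simp: edge_of_def\<close>)
    let ?O = "orbit (corners G) {arc G, side G} c"
    have "arc G c \<in> ?O" "side G c \<in> ?O"
      using orbit_step[OF orbit_self c, of "arc G"] orbit_step[OF orbit_self c, of "side G"] by simp_all
    moreover have "arc G (side G c) \<in> ?O"
      using orbit_step[OF calculation(2) C(4), of "arc G"] by simp
    ultimately show "edge_of G c \<subseteq> ?O" by (simp add: edge_of_def orbit_self)
  qed
  then show ?thesis by (auto simp: edges_def orbits_image)
qed

lemma edge_of_eq:
  assumes "ribbon_graph G" "c \<in> corners G" "d \<in> edge_of G c"
  shows "d \<in> corners G" "edge_of G d = edge_of G c"
proof -
  note G = ribbon_graphD[OF assms(1)]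
  note C = matching_onD[OF G(2) assms(2)] matching_onD[OF G(3) assms(2)]
  note C' = matching_onD[OF G(2) C(4)] matching_onD[OF G(3) C(1)] G(5)[OF assms(2)]
  show "d \<in> corners G" using assms(2,3) C C' by (auto simp: edge_of_def)
  show "edge_of G d = edge_of G c"
    using assms(3) C C' G(5)[OF C(1)] G(5)[OF C(4)] by (auto simp: edge_of_def)
qed

lemma edge_member:
  assumes "ribbon_graph G" "v \<in> edges G" "c \<in> v"
  shows "c \<in> corners G" "v = edge_of G c"
proof -
  obtain b where b: "b \<in> corners G" "v = edge_of G b"
    using assms(2) by (auto simp: edges_eq[OF assms(1)])
  show "c \<in> corners G" "v = edge_of G c"
    using edge_of_eq[OF assms(1) b(1)] assms(3) b(2) by simp_all
qed

lemma edge_matching: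
  assumes "ribbon_graph G" "v \<in> edges G"
  shows "matching_on v (arc G)" "matching_on v (side G)" "matching_on v (\<lambda>c. side G (arc G c))"
proof -
  note G = ribbon_graphD[OF assms(1)]
  have mem: "arc G c \<in> v" "side G c \<in> v" "side G (arc G c) \<in> v" "c \<in> corners G" if c: "c \<in> v" for c
    using edge_member[OF assms c] G(5) by (auto simp: edge_of_def)
  have sa: "side G (arc G (side G (arc G c))) = c" if c: "c \<in> corners G" for c
    using G(5)[OF matching_onD(1)[OF G(2) c]] matching_onD[OF G(2) c]
      matching_onD[OF G(3) c] by simp
  have ne: "side G (arc G c) \<noteq> c" if c: "c \<in> corners G" for c
    using G(5,6)[OF c] by simp
  have "matching_on (corners G) (\<lambda>c. side G (arc G c))"
    using matching_onD(1)[OF G(2)] matching_onD(1)[OF G(3)] sa ne by (simp add: matching_on_def)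
  moreover have "v \<subseteq> corners G" using mem(4) by blast
  ultimately show "matching_on v (arc G)" "matching_on v (side G)"
    "matching_on v (\<lambda>c. side G (arc G c))"
    using matching_on_subset[OF G(2) _ mem(1)] matching_on_subset[OF G(3) _ mem(2)]
      matching_on_subset[OF _ _ mem(3)] by simp_all
qed

lemma corners_of_edge_distinct:
  assumes "ribbon_graph G" "c \<in> corners G"
  shows "distinct [c, arc G c, side G c, arc G (side G c)]"
proof -
  note G = ribbon_graphD[OF assms(1)]
  note C = matching_onD[OF G(2) assms(2)] matching_onD[OF G(3) assms(2)]
  have "arc G c \<noteq> side G c"
  proof
    assume "arc G c = side G c"
    then have "arc G (side G c) = c" using C(3) by simp
    then show False using G(6)[OF assms(2)] by simp
  qed
  moreover have "arc G c \<noteq> arc G (side G c)"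
  proof
    assume "arc G c = arc G (side G c)"
    then have "arc G (arc G c) = arc G (arc G (side G c))" by simp
    then show False using C(3,5) matching_onD(3)[OF G(2) C(4)] by simp
  qed
  moreover note C(2,5) matching_onD(2)[OF G(2) C(4)] G(6)[OF assms(2)]
  ultimately show ?thesis by auto
qed

lemma finite_edges: "ribbon_graph G \<Longrightarrow> finite (edges G)"
  by (simp add: edges_eq ribbon_graphD(1))

lemma Union_edges:
  assumes "ribbon_graph G"
  shows "\<Union>(edges G) = corners G"
proof
  show "\<Union>(edges G) \<subseteq> corners G" using edge_member(1)[OF assms] by blast
  show "corners G \<subseteq> \<Union>(edges G)" by (auto simp: edges_eq[OF assms] edge_of_def)
qed

section \<open>Removing an edge\<close>

text \<open>
  These are the colourings of the medial graph without its free-loops: the medial edges that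
  are not free-loops are the vertex lines, each with two corners as half-edges.
\<close>

definition vertex_colourings :: "nat \<Rightarrow> ('c, 'm) ribbon_scheme \<Rightarrow> ('c \<Rightarrow> nat) set" where
  "vertex_colourings k G =
     {f \<in> corners G \<rightarrow>\<^sub>E {1..k}. \<forall>c\<in>corners G. f (vline G c) = f c}"

lemma finite_vertex_colourings: "finite (corners G) \<Longrightarrow> finite (vertex_colourings k G)"
  unfolding vertex_colourings_def
  by (intro finite_subset[OF _ finite_PiE[of "corners G" "\<lambda>_. {1..k}"]]) auto

text \<open>
  The removal of \<open>e\<close> is studied for an arbitrary pairing \<open>j\<close> of its corners, which covers deletion,
  contraction and Penrose-contraction at once.
\<close>

locale edge_removal =
  fixes G :: "('c, 'm) ribbon_scheme" and e :: "'c set" and j :: "'c \<Rightarrow> 'c"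
  assumes ribbon: "ribbon_graph G" and edge: "e \<in> edges G" and pairing: "matching_on e j"
begin

definition cross :: "'c \<Rightarrow> 'c" where
  "cross d = (if d \<in> e then vline G (j d) else d)"

text \<open>
  Two crossings are enough to leave \<open>e\<close> whenever the curve leaves it at all, because the
  four corners of \<open>e\<close> form only two pairs. From a corner of \<open>e\<close>, \<open>exit\<close> follows the curve in the
  direction that crosses \<open>e\<close> first.
\<close>

definition exit :: "'c \<Rightarrow> 'c" where
  "exit d = cross (cross d)"

definition closed_curves :: "'c set set" where
  "closed_curves = {C \<in> vertex_curves j e G. C \<subseteq> e}"

text \<open>
  The corners from which one cannot leave \<open>e\<close>; they lie on the boundaries of the new isolated vertices.
\<close>

definition trapped :: "'c set" where
  "trapped = \<Union>closed_curves"

lemma remove_edge_simps: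
  "corners (remove_edge j e G) = corners G - e"
  "arc (remove_edge j e G) = arc G"
  "side (remove_edge j e G) = side G"
  "vline (remove_edge j e G) c = exit (vline G c)"
  "isolated (remove_edge j e G) = isolated G + card closed_curves"
  by (simp_all add: remove_edge_def exit_def cross_def numeral_2_eq_2 closed_curves_def)

lemma e_subset: "e \<subseteq> corners G"
  using edge_member(1)[OF ribbon edge] by blast

lemma vline_corner:
  assumes "c \<in> corners G"
  shows "vline G c \<in> corners G" "vline G c \<noteq> c" "vline G (vline G c) = c"
  using matching_onD[OF ribbon_graphD(4)[OF ribbon] assms] by auto

lemma j_corner:
  assumes "c \<in> e"
  shows "j c \<in> e" "j c \<noteq> c" "j (j c) = c" "j c \<in> corners G"
  using matching_onD[OF pairing assms] e_subset by auto

lemma arc_outside: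
  assumes "c \<in> corners G" "c \<notin> e"
  shows "arc G c \<in> corners G - e"
proof -
  have "arc G c \<in> corners G" "arc G (arc G c) = c"
    using matching_onD[OF ribbon_graphD(2)[OF ribbon] assms(1)] by auto
  moreover have "arc G c \<notin> e"
    using matching_onD(1)[OF edge_matching(1)[OF ribbon edge]] calculation assms(2) by metis
  ultimately show ?thesis by simp
qed

text \<open>
  The second generator of \<open>vertex_curves\<close>: the curves cross \<open>e\<close> along \<open>j\<close> and pass the ends of all
  other edges along their arcs.
\<close>

abbreviation chord :: "'c \<Rightarrow> 'c" where
  "chord \<equiv> \<lambda>c. if c \<in> e then j c else arc G c"

lemma curve_matching:
  assumes "f \<in> {vline G, chord}"
  shows "matching_on (corners G) f"
proof -
  have "matching_on (corners G) chord"
    using arc_outside j_corner matching_onD[OF ribbon_graphD(2)[OF ribbon]]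
    by (auto simp: matching_on_def)
  then show ?thesis using assms ribbon_graphD(4)[OF ribbon] by auto
qed

lemma curves_orbits: "closed_curves \<subseteq> orbits (corners G) {vline G, chord}"
  by (auto simp: closed_curves_def vertex_curves_def)

lemma trapped_subset: "trapped \<subseteq> e"
  by (auto simp: trapped_def closed_curves_def)

lemma trapped_closed:
  assumes "c \<in> trapped"
  shows "vline G c \<in> trapped" "j c \<in> trapped"
proof -
  obtain C where C: "C \<in> closed_curves" "c \<in> C" using assms by (auto simp: trapped_def)
  have m: "c \<in> corners G" "C = orbit (corners G) {vline G, chord} c"
    using orbits_member[OF curve_matching subsetD[OF curves_orbits C(1)] C(2)] by simp_all
  have "f c \<in> C" if "f \<in> {vline G, chord}" for f
    using orbit_step[OF orbit_self m(1) that] m(2) by simp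
  from this[of "vline G"] this[of chord] have "vline G c \<in> C" "chord c \<in> C" by simp_all
  moreover have "c \<in> e" using assms trapped_subset by auto
  ultimately show "vline G c \<in> trapped" "j c \<in> trapped" using C(1) by (auto simp: trapped_def)
qed

lemma trapped_j_iff: "c \<in> e \<Longrightarrow> j c \<in> trapped \<longleftrightarrow> c \<in> trapped"
  using trapped_closed j_corner by metis

lemma trapped_vline_iff: "c \<in> corners G \<Longrightarrow> vline G c \<in> trapped \<longleftrightarrow> c \<in> trapped"
  using trapped_closed vline_corner by metis

lemma trappedI:
  assumes "c \<in> X" "X \<subseteq> e" "\<And>d. d \<in> X \<Longrightarrow> vline G d \<in> X" "\<And>d. d \<in> X \<Longrightarrow> j d \<in> X"
  shows "c \<in> trapped"
proof -
  have "orbit (corners G) {vline G, chord} c \<subseteq> X"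
    by (rule orbit_least) (use assms in auto)
  moreover have "orbit (corners G) {vline G, chord} c \<in> vertex_curves j e G"
    using assms(1,2) e_subset by (auto simp: vertex_curves_def orbits_image)
  ultimately show ?thesis
    using assms(2) orbit_self by (fastforce simp: trapped_def closed_curves_def)
qed

text \<open>
  Suppose that the curve from a corner \<open>c\<close> of \<open>e\<close> is still inside \<open>e\<close> after two crossings, and let
  \<open>a = j c\<close>, \<open>b = vline a\<close> and \<open>d = j b\<close>. Either \<open>b = c\<close>, and the curve has closed up, or
  \<open>c, a, b, d\<close> are all the corners of \<open>e\<close>; then \<open>vline d\<close> can only be \<open>c\<close>, because
  \<open>a\<close> and \<open>b\<close> are taken, and the curve closes up after passing through all four.
\<close>

lemma exit_outside:
  assumes "c \<in> corners G" "c \<notin> trapped"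
  shows "exit c \<in> corners G - e"
proof (cases "c \<in> e")
  case False
  then show ?thesis using assms(1) by (simp add: exit_def cross_def)
next
  case c: True
  have out: "cross d \<in> corners G" if "d \<in> corners G" for d
    using that vline_corner j_corner by (simp add: cross_def)
  have "exit c \<notin> e"
  proof
    assume ex: "exit c \<in> e"
    define a b d where abd: "a = j c" "b = vline G a" "d = j b"
    have b: "cross c = b" using c by (simp add: cross_def abd)
    have "b \<in> e" using ex b by (auto simp: exit_def cross_def split: if_splits)
    then have ex': "vline G d \<in> e" using ex b by (simp add: exit_def cross_def abd)
    note C = j_corner[OF c, folded abd] and B = j_corner[OF \<open>b \<in> e\<close>, folded abd]
    have vb: "vline G b = a" "b \<noteq> a" using vline_corner[OF C(4)] by (simp_all add: abd)
    show False
    proof (cases "b = c")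
      case True
      have "c \<in> trapped"
        by (rule trappedI[of c "{c, a}"]) (use True C c vb abd in auto)
      then show False using assms(2) by simp
    next
      case bc: False
      have ds: "d \<noteq> c" "d \<noteq> a" "d \<noteq> b" using B C bc vb abd by metis+
      have "card e = 4"
      proof -
        have "e = set [c, arc G c, side G c, arc G (side G c)]"
          using edge_member(2)[OF ribbon edge c] by (simp add: edge_of_def)
        then show ?thesis 
          using distinct_card[OF corners_of_edge_distinct[OF ribbon assms(1)]] by simp
      qed
      moreover have "card {c, a, b, d} = 4" using ds bc vb C by auto
      moreover have "{c, a, b, d} \<subseteq> e" using c C B \<open>b \<in> e\<close> by simp
      ultimately have e: "e = {c, a, b, d}"
        by (metis card_subset_eq card.infinite zero_neq_numeral)
      have "vline G d \<noteq> d" "vline G d \<noteq> a" "vline G d \<noteq> b"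
        using vline_corner[OF B(4)] vb ds abd vline_corner[OF C(4)] by metis+
      then have vd: "vline G d = c" using ex' e by auto
      then have vc: "vline G c = d" using vline_corner[OF B(4)] by simp
      have "c \<in> trapped"
        by (rule trappedI[of c e]) (use e vb vd vc abd C B in auto)
      then show False using assms(2) by simp
    qed
  qed
  then show ?thesis using assms(1) out by (simp add: exit_def)
qed

lemma exit_outside_id: "c \<notin> e \<Longrightarrow> exit c = c"
  by (simp add: exit_def cross_def)

text \<open>
  Arriving at \<open>c\<close> and following the vertex line out of \<open>c\<close> is the same as starting to cross at \<open>j c\<close>.
\<close>

lemma exit_vline:
  assumes "c \<in> e" "c \<notin> trapped"
  shows "exit (vline G c) = exit (j c)"
proof -
  have x: "exit (j c) = cross (vline G c)"
    using j_corner[OF assms(1)] by (simp add: exit_def cross_def)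
  have "exit (j c) \<notin> e"
    using exit_outside[of "j c"] j_corner[OF assms(1)] trapped_j_iff[OF assms(1)] assms(2) by auto
  then show ?thesis using x by (simp add: exit_def cross_def[of "cross _"])
qed

text \<open>
  The two ends of the curve through \<open>c\<close>, which are \<open>exit c\<close> and \<open>exit (j c)\<close>, are joined by a new
  vertex line.
\<close>

lemma exit_j:
  assumes "c \<in> e" "c \<notin> trapped"
  shows "exit (vline G (exit c)) = exit (j c)"
proof (cases "cross c \<in> e")
  case False
  then have "exit c = vline G (j c)" using assms(1) by (auto simp: exit_def cross_def)
  then show ?thesis using vline_corner[OF j_corner(4)[OF assms(1)]] by simp
next
  case h: True
  have hc: "cross c = vline G (j c)" using assms(1) by (simp add: cross_def)
  then have vh: "vline G (cross c) = j c" using vline_corner[OF j_corner(4)[OF assms(1)]] by simp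
  have nt: "cross c \<notin> trapped"
    using hc trapped_vline_iff[OF j_corner(4)[OF assms(1)]] trapped_j_iff[OF assms(1)] assms(2)
    by simp
  have "exit c = vline G (j (cross c))" using h by (simp add: exit_def cross_def[of "cross c"])
  then have "exit (vline G (exit c)) = exit (j (cross c))"
    using vline_corner[OF j_corner(4)[OF h]] by simp
  also have "\<dots> = exit (vline G (cross c))" using exit_vline[OF h nt] by simp
  finally show ?thesis using vh by simp
qed

lemma new_vline_matching: "matching_on (corners G - e) (\<lambda>c. exit (vline G c))"
  unfolding matching_on_def
proof (intro ballI conjI)
  fix c assume c: "c \<in> corners G - e"
  then have nt: "vline G c \<notin> trapped" using trapped_vline_iff trapped_subset by auto
  note V = vline_corner[of c]
  show "exit (vline G c) \<in> corners G - e" by (rule exit_outside) (use c V nt in auto)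
  show "exit (vline G c) \<noteq> c"
  proof (cases "vline G c \<in> e")
    case False then show ?thesis using exit_outside_id V c by simp
  next
    case True
    let ?d = "vline G c"
    note J = j_corner[OF True]
    show ?thesis
    proof
      assume eq: "exit ?d = c"
      show False
      proof (cases "cross ?d \<in> e")
        case False
        then have "vline G (j ?d) = c" using eq True by (auto simp: exit_def cross_def)
        then show False using J vline_corner[OF J(4)] by simp
      next
        case h: True
        then have "vline G (j (cross ?d)) = c" using eq by (simp add: exit_def cross_def[of "cross _"])
        then have "j (cross ?d) = ?d" using vline_corner[OF j_corner(4)[OF h]] by simp
        then have "cross ?d = j ?d" using j_corner(3)[OF h] by simp
        then show False using True vline_corner(2)[OF J(4)] by (simp add: cross_def)
      qed
    qed
  qed
  show "exit (vline G (exit (vline G c))) = c"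
  proof (cases "vline G c \<in> e")
    case False then show ?thesis using exit_outside_id V c by simp
  next
    case True
    have "exit (vline G (exit (vline G c))) = exit (j (vline G c))" by (rule exit_j[OF True nt])
    also have "\<dots> = exit (vline G (vline G c))" using exit_vline[OF True nt] by simp
    also have "\<dots> = c" using c V exit_outside_id by simp
    finally show ?thesis .
  qed
qed

lemma remove_edge_ribbon: "ribbon_graph (remove_edge j e G)"
proof -
  have *: "matching_on (corners G - e) f" if "matching_on (corners G) f" "matching_on e f" for f
    using that unfolding matching_on_def by (metis Diff_iff)
  have v: "vline (remove_edge j e G) = (\<lambda>c. exit (vline G c))" by (rule ext) (rule remove_edge_simps)
  show ?thesis
    using ribbon_graphD[OF ribbon] edge_matching[OF ribbon edge] new_vline_matching
    by (auto simp: ribbon_graph_def remove_edge_simps v intro!: *)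
qed

lemma remove_edge_edges: "edges (remove_edge j e G) = edges G - {e}"
proof -
  have eo: "edge_of (remove_edge j e G) = edge_of G"
    by (rule ext) (simp add: edge_of_def remove_edge_simps)
  have "edge_of G c = e \<longleftrightarrow> c \<in> e" if "c \<in> corners G" for c
  proof
    show "c \<in> e" if "edge_of G c = e" using that by (auto simp: edge_of_def)
    show "edge_of G c = e" if "c \<in> e" using edge_member(2)[OF ribbon edge that] by simp
  qed
  then show ?thesis
    by (auto simp: edges_eq[OF ribbon] edges_eq[OF remove_edge_ribbon] eo remove_edge_simps)
qed

text \<open>
  Every corner that is not trapped is joined by its curve to \<open>exit c\<close> outside \<open>e\<close>, where its colour
  can be read off; the colours on the trapped corners are independent of the rest. The inverse
  of the restriction colours each corner accordingly.
\<close>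

lemma bij_betw_restrict_colouring:
  "bij_betw (\<lambda>f. (restrict f (corners G - e), restrict f trapped))
     {f \<in> vertex_colourings k G. \<forall>c\<in>e. f (j c) = f c}
     (vertex_colourings k (remove_edge j e G) \<times>
      {g \<in> trapped \<rightarrow>\<^sub>E {1..k}. \<forall>c\<in>trapped. \<forall>f\<in>{vline G, chord}. g (f c) = g c})"
  (is "bij_betw ?res ?A (?B \<times> ?C)")
proof (rule bij_betw_byWitness
    [where f' = "\<lambda>(f, g). \<lambda>c\<in>corners G. if c \<in> trapped then g c else f (exit c)"])
  let ?ext = "\<lambda>(f, g). \<lambda>c\<in>corners G. if c \<in> trapped then g c else f (exit c)"
  have t_e: "c \<in> e" if "c \<in> trapped" for c using that trapped_subset by auto
  have t_S: "c \<in> corners G" if "c \<in> trapped" for c using t_e[OF that] e_subset by auto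
  have A: "f \<in> corners G \<rightarrow>\<^sub>E {1..k}" "\<And>c. c \<in> corners G \<Longrightarrow> f (vline G c) = f c"
    "\<And>c. c \<in> e \<Longrightarrow> f (j c) = f c" if "f \<in> ?A" for f
    using that by (auto simp: vertex_colourings_def)
  have cross_inv: "cross c \<in> corners G \<and> f (cross c) = f c" if "f \<in> ?A" "c \<in> corners G" for f c
    using A(2,3)[OF that(1)] that(2) j_corner vline_corner by (simp add: cross_def)
  have exit_inv: "f (exit c) = f c" if "f \<in> ?A" "c \<in> corners G" for f c
    using cross_inv[OF that(1)] that(2) by (simp add: exit_def)
  show "\<forall>f\<in>?A. ?ext (?res f) = f"
  proof
    fix f assume f: "f \<in> ?A"
    show "?ext (?res f) = f"
    proof
      fix c
      show "?ext (?res f) c = f c"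
        using exit_inv[OF f] exit_outside[of c] PiE_arb[OF A(1)[OF f]] by auto
    qed
  qed
  show "\<forall>p\<in>?B \<times> ?C. ?res (?ext p) = p"
  proof
    fix p assume p: "p \<in> ?B \<times> ?C"
    obtain f g where fg: "p = (f, g)" by (cases p)
    then have f: "f \<in> corners G - e \<rightarrow>\<^sub>E {1..k}" and g: "g \<in> trapped \<rightarrow>\<^sub>E {1..k}"
      using p by (auto simp: vertex_colourings_def remove_edge_simps)
    have "fst (?res (?ext p)) c = fst p c" for c
      using t_e[of c] exit_outside_id[of c] PiE_arb[OF f, of c] by (auto simp: fg)
    moreover have "snd (?res (?ext p)) c = snd p c" for c
      using t_S[of c] PiE_arb[OF g, of c] by (cases "c \<in> trapped") (simp_all add: fg)
    ultimately show "?res (?ext p) = p" by (intro prod_eqI ext)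
  qed
  show "?res ` ?A \<subseteq> ?B \<times> ?C"
  proof
    fix p assume "p \<in> ?res ` ?A"
    then obtain f where f: "f \<in> ?A" "p = ?res f" by blast
    note F = A[OF f(1)]
    have "restrict f (corners G - e) \<in> ?B"
    proof -
      have "restrict f (corners G - e) (exit (vline G c)) = restrict f (corners G - e) c"
        if c: "c \<in> corners G - e" for c
        using matching_onD(1)[OF new_vline_matching c] exit_inv[OF f(1), of "vline G c"]
          F(2)[of c] vline_corner(1)[of c] c by simp
      then show ?thesis
        using PiE_mem[OF F(1)] by (auto simp: vertex_colourings_def remove_edge_simps)
    qed
    moreover have "restrict f trapped \<in> ?C"
      using PiE_mem[OF F(1)] F(2,3) t_e t_S trapped_closed by auto
    ultimately show "p \<in> ?B \<times> ?C" using f(2) by simp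
  qed
  show "?ext ` (?B \<times> ?C) \<subseteq> ?A"
  proof
    fix u assume "u \<in> ?ext ` (?B \<times> ?C)"
    then obtain f g where f: "f \<in> ?B" and g: "g \<in> ?C" and u: "u = ?ext (f, g)" by auto
    have fr: "f \<in> corners G - e \<rightarrow>\<^sub>E {1..k}"
      and fv: "\<And>c. c \<in> corners G - e \<Longrightarrow> f (exit (vline G c)) = f c"
      using f by (auto simp: vertex_colourings_def remove_edge_simps)
    have gr: "g \<in> trapped \<rightarrow>\<^sub>E {1..k}"
      and gv: "\<And>c. c \<in> trapped \<Longrightarrow> g (vline G c) = g c"
      and gj: "\<And>c. c \<in> trapped \<Longrightarrow> g (j c) = g c"
      using g t_e by auto
    have u_t: "u c = g c" if "c \<in> trapped" for c using that t_S u by simp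
    have u_n: "u c = f (exit c)" if "c \<in> corners G" "c \<notin> trapped" for c using that u by simp
    have range: "u \<in> corners G \<rightarrow>\<^sub>E {1..k}"
    proof (rule PiE_I)
      fix c assume c: "c \<in> corners G"
      show "u c \<in> {1..k}"
      proof (cases "c \<in> trapped")
        case True
        show ?thesis unfolding u_t[OF True] by (rule PiE_mem[OF gr True])
      next
        case False
        show ?thesis unfolding u_n[OF c False]
          by (rule PiE_mem[OF fr exit_outside[OF c False]])
      qed
    qed (use u in simp)
    have uj: "u (j c) = u c" if c: "c \<in> e" for c
    proof (cases "c \<in> trapped")
      case True
      then show ?thesis using trapped_closed(2)[OF True] gj u_t by simp
    next
      case False
      have cS: "c \<in> corners G" using c e_subset by auto
      have "u (j c) = f (exit (j c))"
        using u_n j_corner(4)[OF c] trapped_j_iff[OF c] False by simp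
      also have "\<dots> = f (exit (vline G (exit c)))" using exit_j[OF c False] by simp
      also have "\<dots> = f (exit c)" by (rule fv[OF exit_outside[OF cS False]])
      finally show ?thesis using u_n[OF cS False] by simp
    qed
    have uv: "u (vline G c) = u c" if c: "c \<in> corners G" for c
    proof (cases "c \<in> trapped")
      case True
      then show ?thesis using trapped_closed(1)[OF True] gv u_t by simp
    next
      case False
      have vt: "u (vline G c) = f (exit (vline G c))"
        using u_n vline_corner(1)[OF c] trapped_vline_iff[OF c] False by simp
      show ?thesis
      proof (cases "c \<in> e")
        case True
        have "u (vline G c) = u (j c)"
          using vt exit_vline[OF True False] u_n j_corner(4)[OF True] trapped_j_iff[OF True] False
          by simp
        then show ?thesis using uj[OF True] by simp
      next
        case out: False
        then show ?thesis using vt fv c u_n[OF c False] exit_outside_id[OF out] by simp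
      qed
    qed
    show "u \<in> ?A" using range uj uv by (simp add: vertex_colourings_def)
  qed
qed

text \<open>
  The hypothesis says that \<open>h\<close> only sees the colours outside \<open>e\<close>, as does the product of the
  factors of the other edges. The colours of the closed curves are then free, which gives the
  factor that the state sum of the smaller graph has for its new isolated vertices.
\<close>

lemma sum_colourings_remove_edge:
  fixes h :: "('c \<Rightarrow> nat) \<Rightarrow> 'a::comm_semiring_1"
  assumes local: "\<And>f g. (\<And>c. c \<in> corners G - e \<Longrightarrow> f c = g c) \<Longrightarrow> h f = h g"
  shows "(\<Sum>f\<in>{f \<in> vertex_colourings k G. \<forall>c\<in>e. f (j c) = f c}. h f) =
    of_nat k ^ card closed_curves * (\<Sum>f\<in>vertex_colourings k (remove_edge j e G). h f)"
    (is "sum h ?A = _ * sum h ?B")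
proof -
  let ?C = "{g \<in> trapped \<rightarrow>\<^sub>E {1..k}. \<forall>c\<in>trapped. \<forall>f\<in>{vline G, chord}. g (f c) = g c}"
  have C: "card ?C = k ^ card closed_curves"
    using card_invariant_functions[OF ribbon_graphD(1)[OF ribbon] curve_matching curves_orbits,
        where B = "{1..k}"] by (simp add: trapped_def)
  have "sum h ?A = (\<Sum>f\<in>?A. h (fst (restrict f (corners G - e), restrict f trapped)))"
    by (rule sum.cong[OF refl]) (simp, rule local, simp)
  also have "\<dots> = (\<Sum>p\<in>?B \<times> ?C. h (fst p))"
    by (rule sum.reindex_bij_betw[OF bij_betw_restrict_colouring])
  also have "\<dots> = (\<Sum>f\<in>?B. \<Sum>g\<in>?C. h f)"
    by (subst sum.cartesian_product) (simp only: case_prod_unfold)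
  also have "\<dots> = of_nat (card ?C) * sum h ?B"
    by (simp add: sum_distrib_left)
  finally show ?thesis unfolding C by simp
qed

end

section \<open>The state sum\<close>

definition monochrome :: "('c \<Rightarrow> nat) \<Rightarrow> 'c set \<Rightarrow> bool" where
  "monochrome f v \<longleftrightarrow> (\<forall>c\<in>v. \<forall>d\<in>v. f c = f d)"

definition invariant_on :: "'c set \<Rightarrow> ('c \<Rightarrow> 'c) \<Rightarrow> ('c \<Rightarrow> nat) \<Rightarrow> bool" where
  "invariant_on v j f \<longleftrightarrow> (\<forall>c\<in>v. f (j c) = f c)"

text \<open>
  The four terms correspond to the four terms in the recursion for \<open>Omega\<close>. Unlike the
  white, black and crossing configurations, the three pairings are not exclusive: all of them hold at
  a total vertex, which is why the total vertices get \<open>w + x + y + z\<close>.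
\<close>

definition local_weight :: "'c ep_ribbon \<Rightarrow> ('c \<Rightarrow> nat) \<Rightarrow> 'c set \<Rightarrow> wxyz" where
  "local_weight G f v =
     (if v \<in> dark G then of_bool (monochrome f v)
      else var_w * of_bool (monochrome f v)
         + var_x * of_bool (invariant_on v (side G) f)
         + var_y * of_bool (invariant_on v (arc G) f)
         + var_z * of_bool (invariant_on v (\<lambda>c. side G (arc G c)) f))"

text \<open>
  The factor in front accounts for the colours of the free-loops.
\<close>

definition state_sum :: "nat \<Rightarrow> 'c ep_ribbon \<Rightarrow> wxyz" where
  "state_sum k G =
     of_nat k ^ isolated G * (\<Sum>f\<in>vertex_colourings k G. \<Prod>v\<in>edges G. local_weight G f v)"

lemma local_weight_cong:
  assumes "ribbon_graph G" "v \<in> edges G" "\<And>c. c \<in> v \<Longrightarrow> f c = g c"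
  shows "local_weight G f v = local_weight G g v"
proof -
  note m = edge_matching[OF assms(1,2)]
  have "monochrome f v = monochrome g v"
    "invariant_on v (side G) f = invariant_on v (side G) g"
    "invariant_on v (arc G) f = invariant_on v (arc G) g"
    "invariant_on v (\<lambda>c. side G (arc G c)) f = invariant_on v (\<lambda>c. side G (arc G c)) g"
    using matching_onD(1)[OF m(1)] matching_onD(1)[OF m(2)] matching_onD(1)[OF m(3)] assms(3)
    by (simp_all add: monochrome_def invariant_on_def)
  then show ?thesis by (simp add: local_weight_def)
qed

lemma even_colour_classes_iff:
  fixes f :: "'c \<Rightarrow> nat"
  assumes "distinct [a, b, c, d]" "f ` {a, b, c, d} \<subseteq> I"
  shows "(\<forall>i\<in>I. even (card {x \<in> {a, b, c, d}. f x = i})) \<longleftrightarrow>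
    f a = f b \<and> f c = f d \<or> f a = f c \<and> f b = f d \<or> f a = f d \<and> f b = f c"
    (is "?L \<longleftrightarrow> ?R")
proof -
  have card: "card {x \<in> {a, b, c, d}. f x = i} =
      of_bool (f a = i) + of_bool (f b = i) + of_bool (f c = i) + of_bool (f d = i)" for i
  proof -
    have "card {x \<in> {a, b, c, d}. f x = i} = (\<Sum>x\<in>{a, b, c, d}. of_bool (f x = i))"
      by (simp add: Int_def)
    then show ?thesis using assms(1) by simp
  qed
  show ?thesis
  proof
    assume ?L
    \<comment> \<open>If three colour classes are even, then so is the fourth.\<close>
    then have "even (card {x \<in> {a, b, c, d}. f x = f a})" "even (card {x \<in> {a, b, c, d}. f x = f b})"
      "even (card {x \<in> {a, b, c, d}. f x = f c})"
      using assms(2) by auto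
    then show ?R unfolding card by (auto simp: of_bool_def split: if_splits)
  next
    assume ?R
    then show ?L unfolding card by (intro ballI, elim disjE conjE) auto
  qed
qed

text \<open>
  The evenness condition at a medial vertex in terms of the three pairings. Any two of the
  pairings connect all four corners, so if two of them hold, then so does the third.
\<close>

lemma edge_patterns:
  assumes G: "ribbon_graph G" and v: "v \<in> edges G" and f: "f ` v \<subseteq> I"
  defines "S \<equiv> invariant_on v (side G) f" and "A \<equiv> invariant_on v (arc G) f"
    and "X \<equiv> invariant_on v (\<lambda>c. side G (arc G c)) f"
  shows "(\<forall>i\<in>I. even (card {c \<in> v. f c = i})) \<longleftrightarrow> S \<or> A \<or> X"
    and "monochrome f v \<longleftrightarrow> S \<and> A" and "monochrome f v \<longleftrightarrow> S \<and> X" and "monochrome f v \<longleftrightarrow> A \<and> X"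
proof -
  obtain c where c: "c \<in> corners G" and "v = edge_of G c" using v by (auto simp: edges_eq[OF G])
  then have ve: "v = {c, arc G c, side G c, arc G (side G c)}" by (simp add: edge_of_def)
  note D = ribbon_graphD[OF G]
  note C = matching_onD[OF D(2) c] matching_onD[OF D(3) c]
  define a s r where asr: "a = arc G c" "s = side G c" "r = arc G (side G c)"
  have val: "arc G c = a" "side G c = s" "arc G a = c" "side G s = c" "arc G s = r" "side G a = r"
    "arc G r = s" "side G r = a"
    using C matching_onD(3)[OF D(2) C(4)] matching_onD(3)[OF D(3) C(1)] D(5)[OF c]
    by (simp_all add: asr)
  have v4: "v = {c, a, s, r}" by (simp add: ve asr)
  have S: "S \<longleftrightarrow> f c = f s \<and> f a = f r" and A: "A \<longleftrightarrow> f c = f a \<and> f s = f r"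
    and X: "X \<longleftrightarrow> f c = f r \<and> f a = f s" and M: "monochrome f v \<longleftrightarrow> f c = f a \<and> f c = f s \<and> f c = f r"
    by (auto simp: S_def A_def X_def v4 val monochrome_def invariant_on_def)
  show "monochrome f v \<longleftrightarrow> S \<and> A" "monochrome f v \<longleftrightarrow> S \<and> X" "monochrome f v \<longleftrightarrow> A \<and> X"
    unfolding S A X M by auto
  have "distinct [c, a, s, r]" using corners_of_edge_distinct[OF G c] by (simp add: asr)
  then show "(\<forall>i\<in>I. even (card {c \<in> v. f c = i})) \<longleftrightarrow> S \<or> A \<or> X"
    unfolding S A X using even_colour_classes_iff[of c a s r f I] f by (auto simp: v4)
qed

lemma power_card_filter:
  fixes x :: "'a::comm_monoid_mult"
  assumes "finite A"
  shows "x ^ card {a \<in> A. P a} = (\<Prod>a\<in>A. if P a then x else 1)"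
  using prod.inter_filter[OF assms, of "\<lambda>_. x" P] by simp

text \<open>
  A medial edge that is not a free-loop is stored as the set of its half-edges; the inverse map colours
  it by either of them, and both choices agree as the colouring is constant on vertex lines.
\<close>

lemma bij_betw_half_edge_colouring:
  assumes G: "ribbon_graph G"
  shows "bij_betw (\<lambda>\<phi>. (\<lambda>c\<in>corners G. \<phi> (edge_of_half G c), \<lambda>i\<in>{..<isolated G}. \<phi> (Free_Loop i)))
    (medial_edges G \<rightarrow>\<^sub>E {1..k}) (vertex_colourings k G \<times> ({..<isolated G} \<rightarrow>\<^sub>E {1..k}))"
    (is "bij_betw ?to ?A (?B \<times> ?C)")
proof (rule bij_betw_byWitness[where f' = "\<lambda>(f, g). \<lambda>m\<in>medial_edges G.
    case m of Line s \<Rightarrow> f (SOME c. c \<in> s) | Free_Loop i \<Rightarrow> g i"])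
  let ?from = "\<lambda>(f, g). \<lambda>m\<in>medial_edges G.
    case m of Line s \<Rightarrow> f (SOME c. c \<in> s) | Free_Loop i \<Rightarrow> g i"
  have V: "vline G c \<in> corners G" "vline G (vline G c) = c" if "c \<in> corners G" for c
    using matching_onD[OF ribbon_graphD(4)[OF G] that] by auto
  have line: "edge_of_half G c \<in> medial_edges G" if "c \<in> corners G" for c
    using that by (simp add: medial_edges_def)
  have loop: "Free_Loop i \<in> medial_edges G \<longleftrightarrow> i < isolated G" for i
    by (auto simp: medial_edges_def edge_of_half_def)
  have vline: "edge_of_half G (vline G c) = edge_of_half G c" if "c \<in> corners G" for c
    using V[OF that] by (simp add: edge_of_half_def insert_commute)
  have pick: "(SOME d. d \<in> {c, vline G c}) \<in> {c, vline G c}" for c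
    by (rule someI[of _ c]) simp
  have pick_edge: "edge_of_half G (SOME d. d \<in> {c, vline G c}) = edge_of_half G c"
    and pick_corner: "(SOME d. d \<in> {c, vline G c}) \<in> corners G" if "c \<in> corners G" for c
    using pick[of c] vline[OF that] V(1)[OF that] that by auto
  have pick_val: "f (SOME d. d \<in> {c, vline G c}) = f c" if "f \<in> ?B" "c \<in> corners G" for f c
    using pick[of c] that by (auto simp: vertex_colourings_def)
  show "\<forall>\<phi>\<in>?A. ?from (?to \<phi>) = \<phi>"
  proof
    fix \<phi> assume \<phi>: "\<phi> \<in> ?A"
    show "?from (?to \<phi>) = \<phi>"
    proof
      fix m
      show "?from (?to \<phi>) m = \<phi> m"
      proof (cases "m \<in> medial_edges G")
        case True
        then consider c where "c \<in> corners G" "m = edge_of_half G c" | i where "i < isolated G" "m = Free_Loop i"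
          by (auto simp: medial_edges_def)
        then show ?thesis
        proof cases
          case 1
          then show ?thesis using True pick_corner[OF 1(1)] pick_edge[OF 1(1)]
            by (simp add: edge_of_half_def)
        next
          case 2
          then show ?thesis using True by simp
        qed
      next
        case False then show ?thesis using PiE_arb[OF \<phi>] by simp
      qed
    qed
  qed
  show "\<forall>p\<in>?B \<times> ?C. ?to (?from p) = p"
  proof
    fix p assume p: "p \<in> ?B \<times> ?C"
    obtain f g where fg: "p = (f, g)" "f \<in> ?B" "g \<in> ?C" using p by (cases p) auto
    have fr: "f \<in> corners G \<rightarrow>\<^sub>E {1..k}" using fg(2) by (simp add: vertex_colourings_def)
    have "fst (?to (?from p)) c = fst p c" for c
      using line[of c] pick_val[OF fg(2), of c] PiE_arb[OF fr, of c]
      by (cases "c \<in> corners G") (simp_all add: fg(1) edge_of_half_def)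
    moreover have "snd (?to (?from p)) i = snd p i" for i
      using loop[of i] PiE_arb[OF fg(3), of i] by (cases "i < isolated G") (simp_all add: fg(1))
    ultimately show "?to (?from p) = p" by (intro prod_eqI ext)
  qed
  have "(\<lambda>c\<in>corners G. \<phi> (edge_of_half G c)) \<in> ?B" if "\<phi> \<in> ?A" for \<phi>
    using PiE_mem[OF that line] vline V by (auto simp: vertex_colourings_def)
  moreover have "(\<lambda>i\<in>{..<isolated G}. \<phi> (Free_Loop i)) \<in> ?C" if "\<phi> \<in> ?A" for \<phi>
    using PiE_mem[OF that] loop by auto
  ultimately show "?to ` ?A \<subseteq> ?B \<times> ?C" by blast
  show "?from ` (?B \<times> ?C) \<subseteq> ?A"
  proof
    fix \<phi> assume "\<phi> \<in> ?from ` (?B \<times> ?C)"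
    then obtain f g where f: "f \<in> ?B" and g: "g \<in> ?C" and \<phi>: "\<phi> = ?from (f, g)" by auto
    have fr: "f \<in> corners G \<rightarrow>\<^sub>E {1..k}" using f by (simp add: vertex_colourings_def)
    show "\<phi> \<in> ?A"
    proof (rule PiE_I)
      fix m assume m: "m \<in> medial_edges G"
      then consider c where "c \<in> corners G" "m = edge_of_half G c" | i where "i < isolated G" "m = Free_Loop i"
        by (auto simp: medial_edges_def)
      then show "\<phi> m \<in> {1..k}"
      proof cases
        case 1
        then show ?thesis
          using m pick_val[OF f 1(1)] PiE_mem[OF fr 1(1)] by (simp add: \<phi> edge_of_half_def)
      next
        case 2
        then show ?thesis using m PiE_mem[OF g, of i] by (simp add: \<phi>)
      qed
    qed (simp add: \<phi>)
  qed
qed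

text \<open>
  Both sides are sums over all edge colourings of the medial graph, since a colouring that is not a
  valuation has a vertex with local weight \<open>0\<close>.
\<close>

lemma state_sum_eq_valuation_sum:
  assumes "edge_point_ribbon_graph G"
  shows "state_sum k G = (\<Sum>\<phi>\<in>valuations k G.
    (var_w + var_x + var_y + var_z) ^ tot G \<phi> * var_x ^ wh G \<phi> * var_y ^ bl G \<phi> * var_z ^ cr G \<phi>)"
proof -
  have G: "ribbon_graph G" and dark: "dark G \<subseteq> edges G"
    using assms by (auto simp: edge_point_ribbon_graph_def)
  note fin = finite_edges[OF G] ribbon_graphD(1)[OF G]
  define M where "M = medial_edges G \<rightarrow>\<^sub>E {1..k}"
  define W where "W f = (\<Prod>v\<in>edges G. local_weight G f v)" for f
  define half where "half \<phi> c = \<phi> (edge_of_half G c)" for \<phi> :: "'a medial_edge \<Rightarrow> nat" and c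
  have "finite (medial_edges G)" using fin by (simp add: medial_edges_def)
  then have "finite M" by (simp add: M_def finite_PiE)
  have half_range: "half \<phi> ` v \<subseteq> {1..k}" if "\<phi> \<in> M" "v \<in> edges G" for \<phi> v
    using edge_member(1)[OF G that(2)] PiE_mem[OF that(1)[unfolded M_def]]
    by (fastforce simp: half_def medial_edges_def)
  note pat = edge_patterns[OF G _ half_range]
  have opp: "arc G (side G c) = side G (arc G c)" if "v \<in> edges G" "c \<in> v" for v c
    using ribbon_graphD(5)[OF G edge_member(1)[OF G that]] .
  have term_eq: "(var_w + var_x + var_y + var_z) ^ tot G \<phi> * var_x ^ wh G \<phi> * var_y ^ bl G \<phi> * var_z ^ cr G \<phi>
      = W (half \<phi>)" if \<phi>: "\<phi> \<in> valuations k G" for \<phi>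
  proof -
    have M: "\<phi> \<in> M" using \<phi> by (simp add: valuations_def M_def)
    let ?T = "\<lambda>v. if v \<notin> dark G \<and> total_at G \<phi> v then var_w + var_x + var_y + var_z else 1"
    let ?w = "\<lambda>v. if white_at G \<phi> v then var_x else 1"
    let ?b = "\<lambda>v. if black_at G \<phi> v then var_y else 1"
    let ?c = "\<lambda>v. if crossing_at G \<phi> v then var_z else 1"
    have "?T v * ?w v * ?b v * ?c v = local_weight G (half \<phi>) v" if v: "v \<in> edges G" for v
    proof -
      note p = pat[OF v M v]
      have t: "total_at G \<phi> v \<longleftrightarrow> monochrome (half \<phi>) v" by (simp add: total_at_def half_def monochrome_def)
      have w: "white_at G \<phi> v \<longleftrightarrow> \<not> monochrome (half \<phi>) v \<and> invariant_on v (side G) (half \<phi>)"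
        unfolding white_at_def t invariant_on_def half_def by (simp only: eq_commute)
      have b: "black_at G \<phi> v \<longleftrightarrow> \<not> monochrome (half \<phi>) v \<and> invariant_on v (arc G) (half \<phi>)"
        unfolding black_at_def t invariant_on_def half_def by (simp only: eq_commute)
      have c: "crossing_at G \<phi> v \<longleftrightarrow>
          \<not> monochrome (half \<phi>) v \<and> invariant_on v (\<lambda>c. side G (arc G c)) (half \<phi>)"
      proof -
        have "half \<phi> c = half \<phi> (arc G (side G c)) \<longleftrightarrow> half \<phi> (side G (arc G c)) = half \<phi> c"
          if "c \<in> v" for c
          unfolding opp[OF v that] by (rule eq_commute)
        then show ?thesis unfolding crossing_at_def t by (simp add: half_def invariant_on_def)
      qed
      have ev: "invariant_on v (side G) (half \<phi>) \<or> invariant_on v (arc G) (half \<phi>) \<or>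
          invariant_on v (\<lambda>c. side G (arc G c)) (half \<phi>)"
        unfolding p(1)[symmetric] half_def using \<phi> v by (simp add: valuations_def medial_vertices_def)
      have dk: "monochrome (half \<phi>) v" if "v \<in> dark G"
        unfolding monochrome_def half_def
        using \<phi> that unfolding valuations_def singular_vertices_def by blast
      show ?thesis
        unfolding local_weight_def w b c t using ev dk p(2-4) 
        by (cases "v \<in> dark G"; cases "invariant_on v (side G) (half \<phi>)"; cases "invariant_on v (arc G) (half \<phi>)";
            cases "invariant_on v (\<lambda>c. side G (arc G c)) (half \<phi>)") simp_all
    qed
    moreover have "tot G \<phi> = card {v \<in> edges G. v \<notin> dark G \<and> total_at G \<phi> v}"
      unfolding tot_def by (rule arg_cong[of _ _ card]) (auto simp: medial_vertices_def singular_vertices_def)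
    ultimately show ?thesis
      by (simp add: wh_def bl_def cr_def medial_vertices_def power_card_filter[OF fin(1)]
          W_def flip: prod.distrib)
  qed
  have zero: "W (half \<phi>) = 0" if \<phi>: "\<phi> \<in> M - valuations k G" for \<phi>
  proof -
    have M: "\<phi> \<in> M" using \<phi> by simp
    have "\<exists>v\<in>edges G. local_weight G (half \<phi>) v = 0"
    proof (rule ccontr)
      assume "\<not> ?thesis"
      then have nz: "local_weight G (half \<phi>) v \<noteq> 0" if "v \<in> edges G" for v using that by auto
      have "\<forall>i\<in>{1..k}. even (card {c \<in> v. half \<phi> c = i})" if v: "v \<in> edges G" for v
        unfolding pat(1)[OF v M v] using nz[OF v] pat(2)[OF v M v]
        by (auto simp: local_weight_def of_bool_def split: if_splits)
      moreover have "monochrome (half \<phi>) v" if v: "v \<in> dark G" for v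
        using nz[of v] v dark by (auto simp: local_weight_def of_bool_def split: if_splits)
      ultimately have "\<phi> \<in> valuations k G"
        using M unfolding valuations_def M_def half_def medial_vertices_def singular_vertices_def
          monochrome_def by blast
      then show False using \<phi> by simp
    qed
    then show ?thesis using fin by (simp add: W_def)
  qed
  have W_cong: "W f = W g" if "\<And>c. c \<in> corners G \<Longrightarrow> f c = g c" for f g
    unfolding W_def using that edge_member(1)[OF G] by (intro prod.cong refl local_weight_cong[OF G]) auto
  let ?C = "{..<isolated G} \<rightarrow>\<^sub>E {1..k}"
  have "(\<Sum>\<phi>\<in>valuations k G.
      (var_w + var_x + var_y + var_z) ^ tot G \<phi> * var_x ^ wh G \<phi> * var_y ^ bl G \<phi> * var_z ^ cr G \<phi>)
      = (\<Sum>\<phi>\<in>valuations k G. W (half \<phi>))"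
    by (rule sum.cong[OF refl term_eq])
  also have "\<dots> = (\<Sum>\<phi>\<in>M. W (half \<phi>))"
    by (rule sum.mono_neutral_left[OF \<open>finite M\<close>]) (use zero in \<open>auto simp: valuations_def M_def\<close>)
  also have "\<dots> = (\<Sum>\<phi>\<in>M. W (fst (\<lambda>c\<in>corners G. \<phi> (edge_of_half G c),
      \<lambda>i\<in>{..<isolated G}. \<phi> (Free_Loop i))))"
    by (rule sum.cong[OF refl]) (simp, rule W_cong, simp add: half_def)
  also have "\<dots> = (\<Sum>p\<in>vertex_colourings k G \<times> ?C. W (fst p))"
    unfolding M_def by (rule sum.reindex_bij_betw[OF bij_betw_half_edge_colouring[OF G]])
  also have "\<dots> = (\<Sum>f\<in>vertex_colourings k G. \<Sum>g\<in>?C. W f)"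
    by (subst sum.cartesian_product) (simp only: case_prod_unfold)
  also have "\<dots> = state_sum k G"
    by (simp add: state_sum_def W_def card_funcsetE sum_distrib_left)
  finally show ?thesis by simp
qed

text \<open>
  If all edges are dark, the weight of a colouring is \<open>1\<close> or \<open>0\<close> according to whether it is
  constant on every edge, hence on every component. So the colourings of the components are counted.
\<close>

lemma state_sum_edgeless:
  assumes "edge_point_ribbon_graph G" "light_edges G = {}"
  shows "state_sum k G = of_nat k ^ num_components G"
proof -
  have G: "ribbon_graph G" and dark: "dark G = edges G"
    using assms by (auto simp: edge_point_ribbon_graph_def light_edges_def)
  note fin = finite_edges[OF G] ribbon_graphD(1)[OF G]
  let ?F = "{arc G, side G, vline G}"
  have F: "matching_on (corners G) f" if "f \<in> ?F" for f
    using that ribbon_graphD[OF G] by auto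
  have inv_iff: "(\<forall>v\<in>edges G. monochrome f v) \<longleftrightarrow>
      (\<forall>c\<in>corners G. f (arc G c) = f c \<and> f (side G c) = f c)" (is "?L \<longleftrightarrow> ?R") for f :: "'a \<Rightarrow> nat"
  proof -
    have "monochrome f v \<longleftrightarrow> invariant_on v (side G) f \<and> invariant_on v (arc G) f"
      if "v \<in> edges G" for v
      using edge_patterns(2)[OF G that, of f UNIV] by simp
    then have "?L \<longleftrightarrow> (\<forall>c\<in>\<Union>(edges G). f (arc G c) = f c \<and> f (side G c) = f c)"
      unfolding invariant_on_def by blast
    then show ?thesis unfolding Union_edges[OF G] .
  qed
  have prod_of_bool: "(\<Prod>v\<in>E. of_bool (P v)) = (of_bool (\<forall>v\<in>E. P v) :: wxyz)"
    if "finite E" for E :: "'a set set" and P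
    using that by induction auto
  have "(\<Sum>f\<in>vertex_colourings k G. \<Prod>v\<in>edges G. local_weight G f v)
      = (\<Sum>f\<in>vertex_colourings k G. of_bool (\<forall>v\<in>edges G. monochrome f v))"
    by (simp add: local_weight_def dark prod_of_bool[OF fin(1)])
  also have "\<dots> = of_nat (card {f \<in> vertex_colourings k G. \<forall>v\<in>edges G. monochrome f v})"
    using fin by (simp add: finite_vertex_colourings Int_def)
  also have "{f \<in> vertex_colourings k G. \<forall>v\<in>edges G. monochrome f v} =
      {u \<in> \<Union>(orbits (corners G) ?F) \<rightarrow>\<^sub>E {1..k}. \<forall>c\<in>\<Union>(orbits (corners G) ?F). \<forall>f\<in>?F. u (f c) = u c}"
  proof -
    have "\<Union>(orbits (corners G) ?F) = corners G"
    proof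
      show "\<Union>(orbits (corners G) ?F) \<subseteq> corners G"
        using orbit_subset[of ?F, OF F] by (simp add: orbits_image UN_subset_iff)
      show "corners G \<subseteq> \<Union>(orbits (corners G) ?F)"
        unfolding orbits_image by (auto intro: orbit_self)
    qed
    then show ?thesis unfolding inv_iff by (auto simp: vertex_colourings_def)
  qed
  also have "card \<dots> = k ^ card (orbits (corners G) ?F)"
    using card_invariant_functions[of _ ?F, OF fin(2) F order_refl, where B = "{1..k}"] by simp
  finally show ?thesis by (simp add: state_sum_def num_components_def power_add)
qed

lemma edge_point_contract_to_point:
  assumes "edge_point_ribbon_graph G" "e \<in> light_edges G"
  shows "edge_point_ribbon_graph (contract_to_point G e)"
    "light_edges (contract_to_point G e) = light_edges G - {e}"
proof -
  have eq: "edges (contract_to_point G e) = edges G"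
    by (simp add: edges_def contract_to_point_def)
  have "ribbon_graph (contract_to_point G e) = ribbon_graph G"
    by (simp add: ribbon_graph_def contract_to_point_def)
  then show "edge_point_ribbon_graph (contract_to_point G e)"
    using assms unfolding edge_point_ribbon_graph_def eq
    by (auto simp: contract_to_point_def light_edges_def)
  show "light_edges (contract_to_point G e) = light_edges G - {e}"
    unfolding light_edges_def eq by (auto simp: contract_to_point_def)
qed

lemma state_sum_contract_to_point:
  assumes "edge_point_ribbon_graph G" "e \<in> light_edges G"
  shows "state_sum k (contract_to_point G e) = of_nat k ^ isolated G *
    (\<Sum>f\<in>vertex_colourings k G. of_bool (monochrome f e) * (\<Prod>v\<in>edges G - {e}. local_weight G f v))"
proof -
  have G: "ribbon_graph G" and e: "e \<in> edges G"
    using assms by (auto simp: edge_point_ribbon_graph_def light_edges_def)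
  have eq: "edges (contract_to_point G e) = edges G"
    by (simp add: edges_def contract_to_point_def)
  have "(\<Prod>v\<in>edges G. local_weight (contract_to_point G e) f v) =
      of_bool (monochrome f e) * (\<Prod>v\<in>edges G - {e}. local_weight G f v)" for f
    unfolding prod.remove[OF finite_edges[OF G] e]
    by (intro arg_cong2[of _ _ _ _ "(*)"] prod.cong) (auto simp: local_weight_def contract_to_point_def)
  then show ?thesis
    by (simp add: state_sum_def eq) (simp add: contract_to_point_def vertex_colourings_def)
qed

lemma edge_point_remove_edge:
  assumes "edge_point_ribbon_graph G" "e \<in> light_edges G" "matching_on e j"
  shows "edge_point_ribbon_graph (remove_edge j e G)"
    "light_edges (remove_edge j e G) = light_edges G - {e}"
proof -
  interpret edge_removal G e j
    using assms by unfold_locales (auto simp: edge_point_ribbon_graph_def light_edges_def)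
  have dark: "dark (remove_edge j e G) = dark G" by (simp add: remove_edge_def)
  show "edge_point_ribbon_graph (remove_edge j e G)"
    "light_edges (remove_edge j e G) = light_edges G - {e}"
    using assms remove_edge_ribbon
    by (auto simp: edge_point_ribbon_graph_def light_edges_def remove_edge_edges dark)
qed

text \<open>
  The state sum after removing \<open>e\<close> along \<open>j\<close>, as a sum over the colourings of \<open>G\<close> itself. In
  this form the four operations can be compared term by term.
\<close>

lemma state_sum_remove_edge:
  assumes "edge_point_ribbon_graph G" "e \<in> light_edges G" "matching_on e j"
  shows "state_sum k (remove_edge j e G) = of_nat k ^ isolated G *
    (\<Sum>f\<in>vertex_colourings k G. of_bool (invariant_on e j f) * (\<Prod>v\<in>edges G - {e}. local_weight G f v))"
proof -
  interpret edge_removal G e j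
    using assms by unfold_locales (auto simp: edge_point_ribbon_graph_def light_edges_def)
  let ?h = "\<lambda>f. \<Prod>v\<in>edges G - {e}. local_weight G f v"
  have lw: "local_weight (remove_edge j e G) = local_weight G"
    by (intro ext) (simp add: local_weight_def remove_edge_def)
  have local: "?h f = ?h g" if fg: "\<And>c. c \<in> corners G - e \<Longrightarrow> f c = g c" for f g
  proof (rule prod.cong[OF refl], rule local_weight_cong[OF ribbon])
    fix v c assume v: "v \<in> edges G - {e}" and c: "c \<in> v"
    have "c \<notin> e" using edge_member(2)[OF ribbon _ c] edge_member(2)[OF ribbon edge] v by auto
    then show "f c = g c" using fg edge_member(1)[OF ribbon _ c] v by auto
  qed auto
  have "(\<Sum>f\<in>vertex_colourings k G. of_bool (invariant_on e j f) * ?h f)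
      = (\<Sum>f\<in>{f \<in> vertex_colourings k G. invariant_on e j f}. ?h f)"
    by (simp add: sum.inter_filter[OF finite_vertex_colourings[OF ribbon_graphD(1)[OF ribbon]]]
        of_bool_def if_distrib[of "\<lambda>x. x * _"] cong: if_cong)
  also have "\<dots> = of_nat k ^ card closed_curves * (\<Sum>f\<in>vertex_colourings k (remove_edge j e G). ?h f)"
    unfolding invariant_on_def by (rule sum_colourings_remove_edge[OF local])
  finally show ?thesis
    by (simp add: state_sum_def remove_edge_simps(5) remove_edge_edges lw power_add mult.assoc)
qed

text \<open>
  A half-twist only changes which of the pairings of \<open>e\<close> is called \<open>side\<close>: the diagonal one takes
  this role.
\<close>

lemma partial_petrial_simps:
  assumes "ribbon_graph G" "e \<in> edges G"
  shows "ribbon_graph (partial_petrial G e)" "edges (partial_petrial G e) = edges G"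
    "c \<in> e \<Longrightarrow> side (partial_petrial G e) c = side G (arc G c)"
    "c \<notin> e \<Longrightarrow> side (partial_petrial G e) c = side G c"
proof -
  let ?P = "partial_petrial G e"
  note G = ribbon_graphD[OF assms(1)] and m = edge_matching[OF assms]
  have s: "corners ?P = corners G" "arc ?P = arc G" "vline ?P = vline G"
    "side ?P = (\<lambda>c. if c \<in> e then side G (arc G c) else side G c)"
    by (simp_all add: partial_petrial_def)
  then show "c \<in> e \<Longrightarrow> side ?P c = side G (arc G c)" "c \<notin> e \<Longrightarrow> side ?P c = side G c" by simp_all
  have e: "e \<subseteq> corners G" using edge_member(1)[OF assms] by blast
  have stable: "arc G c \<in> e \<longleftrightarrow> c \<in> e" "side G c \<in> e \<longleftrightarrow> c \<in> e" if "c \<in> corners G" for c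
    using matching_onD[OF m(1)] matching_onD[OF m(2)] matching_onD(3)[OF G(2) that]
      matching_onD(3)[OF G(3) that] by metis+
  have side: "matching_on (corners G) (side ?P)"
    unfolding matching_on_def s(4) using matching_onD[OF G(3)] matching_onD[OF m(3)] e stable
    by (auto simp: subset_iff)
  have comm: "arc G (side ?P c) = side ?P (arc G c) \<and> arc G (side ?P c) \<noteq> c"
    if c: "c \<in> corners G" for c
  proof (cases "c \<in> e")
    case True
    note C = matching_onD[OF G(2) c] matching_onD[OF G(3) c]
    have "arc G (side G (arc G c)) = side G c" using G(5)[OF C(1)] C(3) by simp
    then show ?thesis using True stable[OF c] C by (simp add: s)
  next
    case False
    then show ?thesis using stable[OF c] G(5,6)[OF c] by (simp add: s)
  qed
  show rib: "ribbon_graph ?P"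
    unfolding ribbon_graph_def s(1-3) using G side comm by blast
  have "edge_of ?P c = edge_of G c" if c: "c \<in> corners G" for c
  proof (cases "c \<in> e")
    case True
    note C = matching_onD[OF G(2) c] matching_onD[OF G(3) c]
    have "arc G (side G (arc G c)) = side G c" using G(5)[OF C(1)] C(3) by simp
    then show ?thesis using True G(5)[OF c] by (auto simp: edge_of_def s)
  next
    case False then show ?thesis by (simp add: edge_of_def s)
  qed
  then show "edges ?P = edges G"
    unfolding edges_eq[OF rib] edges_eq[OF assms(1)] s(1) by simp
qed

lemma edge_point_operations:
  assumes "edge_point_ribbon_graph G" "e \<in> light_edges G"
    "H \<in> {contract_to_point G e, contract G e, delete G e, penrose_contract G e}"
  shows "edge_point_ribbon_graph H" "light_edges H = light_edges G - {e}"
proof -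
  have G: "ribbon_graph G" and e: "e \<in> edges G"
    using assms by (auto simp: edge_point_ribbon_graph_def light_edges_def)
  note m = edge_matching[OF G e]
  let ?P = "partial_petrial G e"
  note P = partial_petrial_simps[OF G e]
  have "dark ?P = dark G" by (simp add: partial_petrial_def)
  then have epP: "edge_point_ribbon_graph ?P" and "light_edges ?P = light_edges G"
    using P assms(1) by (simp_all add: edge_point_ribbon_graph_def light_edges_def)
  moreover have "matching_on e (side ?P)"
    by (rule edge_matching) (use P e in simp_all)
  ultimately have "edge_point_ribbon_graph (penrose_contract G e)"
    "light_edges (penrose_contract G e) = light_edges G - {e}"
    using edge_point_remove_edge[of ?P e "side ?P"] assms(2)
    by (simp_all add: penrose_contract_def contract_def)
  moreover note edge_point_contract_to_point[OF assms(1,2)]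
    edge_point_remove_edge[OF assms(1,2) m(1), folded delete_def]
    edge_point_remove_edge[OF assms(1,2) m(2), folded contract_def]
  ultimately show "edge_point_ribbon_graph H" "light_edges H = light_edges G - {e}"
    using assms(3) by auto
qed

text \<open>
  Expand the local weight of \<open>e\<close> in the state sum of \<open>G\<close> into its four terms.
\<close>

lemma state_sum_recursion:
  assumes "edge_point_ribbon_graph G" "e \<in> light_edges G"
  shows "state_sum k G = var_w * state_sum k (contract_to_point G e)
    + var_x * state_sum k (contract G e) + var_y * state_sum k (delete G e)
    + var_z * state_sum k (penrose_contract G e)"
proof -
  have G: "ribbon_graph G" and e: "e \<in> edges G" and light: "e \<notin> dark G"
    using assms by (auto simp: edge_point_ribbon_graph_def light_edges_def)
  note m = edge_matching[OF G e]
  let ?h = "\<lambda>f. \<Prod>v\<in>edges G - {e}. local_weight G f v"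
  let ?sum = "\<lambda>P. of_nat k ^ isolated G * (\<Sum>f\<in>vertex_colourings k G. of_bool (P f) * ?h f)"
  let ?P = "partial_petrial G e"
  note P = partial_petrial_simps[OF G e]
  have penrose: "state_sum k (penrose_contract G e) = ?sum (invariant_on e (\<lambda>c. side G (arc G c)))"
  proof -
    have s: "vertex_colourings k ?P = vertex_colourings k G" "isolated ?P = isolated G"
      "dark ?P = dark G" "arc ?P = arc G"
      by (simp_all add: partial_petrial_def vertex_colourings_def)
    have "edge_point_ribbon_graph ?P" "e \<in> light_edges ?P"
      using P s assms by (simp_all add: edge_point_ribbon_graph_def light_edges_def)
    moreover have "matching_on e (side ?P)"
      by (rule edge_matching) (use P e in simp_all)
    ultimately have "state_sum k (penrose_contract G e) = of_nat k ^ isolated G *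
        (\<Sum>f\<in>vertex_colourings k G. of_bool (invariant_on e (side ?P) f) *
          (\<Prod>v\<in>edges G - {e}. local_weight ?P f v))"
      using state_sum_remove_edge[of ?P e "side ?P" k] P(2) s
      by (simp add: penrose_contract_def contract_def)
    moreover have "local_weight ?P f v = local_weight G f v" if v: "v \<in> edges G - {e}" for f v
    proof -
      have out: "c \<notin> e" "arc G c \<notin> e" if c: "c \<in> v" for c
      proof -
        have "d \<notin> e" if "d \<in> v" for d
          using edge_member(2)[OF G _ that] edge_member(2)[OF G e] v by auto
        then show "c \<notin> e" "arc G c \<notin> e"
          using c matching_onD(1)[OF edge_matching(1)[OF G]] v by blast+
      qed
      then show ?thesis by (simp add: local_weight_def s P(4) invariant_on_def)
    qed
    moreover have "invariant_on e (side ?P) = invariant_on e (\<lambda>c. side G (arc G c))"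
      by (rule ext) (simp add: invariant_on_def P(3))
    ultimately show ?thesis by simp
  qed
  have "state_sum k G = of_nat k ^ isolated G *
      (\<Sum>f\<in>vertex_colourings k G. local_weight G f e * ?h f)"
    unfolding state_sum_def by (simp add: prod.remove[OF finite_edges[OF G] e])
  also have "\<dots> = var_w * ?sum (\<lambda>f. monochrome f e) + var_x * ?sum (invariant_on e (side G))
      + var_y * ?sum (invariant_on e (arc G)) + var_z * ?sum (invariant_on e (\<lambda>c. side G (arc G c)))"
    using light by (simp add: local_weight_def distrib_right sum.distrib distrib_left
        sum_distrib_left mult.left_commute mult.assoc)
  finally show ?thesis
    unfolding penrose contract_def delete_def state_sum_contract_to_point[OF assms]
      state_sum_remove_edge[OF assms m(1)] state_sum_remove_edge[OF assms m(2)] .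
qed

section \<open>The polynomial interpolating the state sums\<close>

lemma poly_eqI_of_nat:
  fixes p q :: "'a::{idom, ring_char_0} poly"
  assumes "\<And>k. poly p (of_nat k) = poly q (of_nat k)"
  shows "p = q"
proof (rule ccontr)
  assume "p \<noteq> q"
  then have "finite {x. poly (p - q) x = 0}" by (intro poly_roots_finite) simp
  moreover have "range of_nat \<subseteq> {x. poly (p - q) x = 0}" using assms by auto
  ultimately have "finite (range (of_nat :: nat \<Rightarrow> 'a))" by (rule rev_finite_subset)
  then show False using finite_imageD[OF _ inj_of_nat] by auto
qed

text \<open>
  Induction on the number of light edges, which each of the four operations lowers by one.
\<close>

lemma light_edge_induct [consumes 1, case_names step]:
  assumes "edge_point_ribbon_graph G"
    and step: "\<And>G. edge_point_ribbon_graph G \<Longrightarrow>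
      (\<And>e H. e \<in> light_edges G \<Longrightarrow>
        H \<in> {contract_to_point G e, contract G e, delete G e, penrose_contract G e} \<Longrightarrow> Q H) \<Longrightarrow> Q G"
  shows "Q G"
  using assms(1)
proof (induction "card (light_edges G)" arbitrary: G rule: less_induct)
  case less
  show ?case
  proof (rule step[OF less.prems])
    fix e H assume e: "e \<in> light_edges G"
      and H: "H \<in> {contract_to_point G e, contract G e, delete G e, penrose_contract G e}"
    have "finite (light_edges G)"
      using less.prems finite_edges by (auto simp: light_edges_def edge_point_ribbon_graph_def)
    then have "card (light_edges H) < card (light_edges G)"
      using edge_point_operations(2)[OF less.prems e H] card_Diff1_less[OF _ e] by simp
    then show "Q H" by (rule less.hyps[OF _ edge_point_operations(1)[OF less.prems e H]])
  qed
qed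

lemma poly_Omega_relations:
  assumes "Omega_relations P" "edge_point_ribbon_graph G"
  shows "poly (P G) (of_nat k) = state_sum k G"
  using assms(2)
proof (induction rule: light_edge_induct)
  case (step G)
  show ?case
  proof (cases "light_edges G = {}")
    case True
    then have "P G = var_t ^ num_components G"
      using assms(1) step.hyps by (simp add: Omega_relations_def)
    then show ?thesis using state_sum_edgeless[OF step.hyps True] by (simp add: var_t_def)
  next
    case False
    then obtain e where e: "e \<in> light_edges G" by auto
    then have "P G = [:var_w:] * P (contract_to_point G e) + [:var_x:] * P (contract G e)
        + [:var_y:] * P (delete G e) + [:var_z:] * P (penrose_contract G e)"
      using assms(1) step.hyps unfolding Omega_relations_def by blast
    then show ?thesis using step.IH[OF e] state_sum_recursion[OF step.hyps e] by simp
  qed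
qed

text \<open>
  Existence of \<open>Omega\<close>. The interpolating polynomial is defined without choosing an order of the
  edges, and the relation for each \<open>e\<close> may be checked at natural numbers, where it is the
  recursion for state sums.
\<close>

lemma Omega_relations_Omega: "Omega_relations (Omega :: 'c ep_ribbon \<Rightarrow> wxyz poly)"
proof -
  let ?interp = "\<lambda>G p. \<forall>k. poly p (of_nat k) = state_sum k G"
  have ex: "\<exists>p. ?interp G p" if "edge_point_ribbon_graph G" for G :: "'c ep_ribbon"
    using that
  proof (induction rule: light_edge_induct)
    case (step G)
    show ?case
    proof (cases "light_edges G = {}")
      case True
      then have "?interp G (var_t ^ num_components G)"
        using state_sum_edgeless[OF step.hyps] by (simp add: var_t_def)
      then show ?thesis ..
    next
      case False
      then obtain e where e: "e \<in> light_edges G" by auto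
      obtain p q r s where "?interp (contract_to_point G e) p" "?interp (contract G e) q"
        "?interp (delete G e) r" "?interp (penrose_contract G e) s"
        using step.IH[OF e] by (metis insertCI)
      then have "?interp G ([:var_w:] * p + [:var_x:] * q + [:var_y:] * r + [:var_z:] * s)"
        using state_sum_recursion[OF step.hyps e] by simp
      then show ?thesis ..
    qed
  qed
  define P where "P G = (SOME p. ?interp G p)" for G :: "'c ep_ribbon"
  have P: "poly (P G) (of_nat k) = state_sum k G" if "edge_point_ribbon_graph G" for G k
    unfolding P_def using someI_ex[OF ex[OF that]] by blast
  have "Omega_relations P"
    unfolding Omega_relations_def
  proof (intro allI impI conjI ballI)
    fix G :: "'c ep_ribbon"
    assume G: "edge_point_ribbon_graph G"
    show "P G = var_t ^ num_components G" if "light_edges G = {}"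
      by (rule poly_eqI_of_nat) (simp add: P[OF G] state_sum_edgeless[OF G that] var_t_def)
    fix e assume e: "e \<in> light_edges G"
    note H = P[OF edge_point_operations(1)[OF G e]]
    show "P G = [:var_w:] * P (contract_to_point G e) + [:var_x:] * P (contract G e)
        + [:var_y:] * P (delete G e) + [:var_z:] * P (penrose_contract G e)"
      by (rule poly_eqI_of_nat) (simp add: P[OF G] H state_sum_recursion[OF G e])
  qed
  then show ?thesis unfolding Omega_def by (rule someI[where P = Omega_relations])
qed

theorem theorem4p2:
  fixes G :: "'c ep_ribbon" and k :: nat
  assumes "edge_point_ribbon_graph G"
  shows "poly (Omega G) (of_nat k) =
    (\<Sum>\<phi>\<in>valuations k G.
       (var_w + var_x + var_y + var_z) ^ tot G \<phi> * var_x ^ wh G \<phi> * var_y ^ bl G \<phi> * var_z ^ cr G \<phi>)"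
  using poly_Omega_relations[OF Omega_relations_Omega assms] state_sum_eq_valuation_sum[OF assms]
  by simp

end
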